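(* Let $n\in\mathbb N$, $n\ge 1$, let $s\in(0,\infty)\setminus\mathbb N$ and let $A$ be a Young function. Assume that there exists a rearrangement-invariant space $Y(\mathbb R^n)$ such that the continuous embedding $$V^{s,A}_d(\mathbb R^n)\to Y(\mathbb R^n)$$ holds. Then $$s\in(0,n)\setminus\mathbb N\qquad\text{and}\qquad \int_0\left(\frac{t}{A(t)}\right)^{\frac{s}{n-s}}dt<\infty .$$
   Context: A Young function is a function $A:[0,\infty)\to[0,\infty]$ which is convex, non-constant, left-continuous, with $A(0)=0$. The notation $\int_0(\cdots)\,dt<\infty$ means that the integral over $(0,\delta)$ is finite for some $\delta>0$; the conventions $t/A(t)=\infty$ if $A(t)=0$, $t>0$, and $t/A(t)=0$ if $A(t)=\infty$ are used. $\mathcal M(\mathbb R^n)$ is the set of measurable functions $u:\mathbb R^n\to\mathbb R$ (identified a.e.); $|E|$ is the Lebesgue measure of $E$. Fractional Orlicz–Sobolev spaces. For $\sigma\in(0,1)$ and $v$ measurable on $\mathbb R^n$ (scalar or vector-valued; $|\cdot|$ is the Euclidean norm), $$J_{\sigma,A}(v)=\int_{\mathbb R^n}\int_{\mathbb R^n}A\left(\frac{|v(x)-v(y)|}{|x-y|^{\sigma}}\right)\frac{dx\,dy}{|x-y|^n},\qquad |v|_{\sigma,A,\mathbb R^n}=\inf\{\lambda>0: J_{\sigma,A}(v/\lambda)\le 1\}.$$ For $s\in(0,\infty)\setminus\mathbb N$, $[s]$ is the integer part, $\{s\}=s-[s]$, and $\nabla^k u$ is the vector of all weak derivatives of order $k$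 of $u$ ($\nabla^0u=u$). Then $V^{s,A}_d(\mathbb R^n)$ is the space of all $u\in\mathcal M(\mathbb R^n)$ that are $[s]$-times weakly differentiable, with $|\nabla^{[s]}u|_{\{s\},A,\mathbb R^n}<\infty$ and $|\{|\nabla^ku|>t\}|<\infty$ for every $t>0$ and $k=0,1,\dots,[s]$. It is endowed with the functional $|\nabla^{[s]}u|_{\{s\},A,\mathbb R^n}$. A rearrangement-invariant space is a Banach function space $Y(\mathbb R^n)$ in the sense of Luxemburg, that is, $Y(\mathbb R^n)=\{u\in\mathcal M(\mathbb R^n):\|u\|_{Y(\mathbb R^n)}<\infty\}$, where the functional $\|\cdot\|_{Y(\mathbb R^n)}:\mathcal M(\mathbb R^n)\to[0,\infty]$ satisfies, for all $u,v,u_k\in\mathcal M(\mathbb R^n)$ ($k\in\mathbb N$), all $\lambda\in\mathbb R$ and all measurable $E\subset\mathbb R^n$: (1) $\|u\|_{Y(\mathbb R^n)}=0$ if and only if $u=0$ a.e., $\|\lambda u\|_{Y(\mathbb R^n)}=|\lambda|\,\|u\|_{Y(\mathbb R^n)}$ (with $0\cdot\infty=0$), $\|u+v\|_{Y(\mathbb R^n)}\le\|u\|_{Y(\mathbb R^n)}+\|v\|_{Y(\mathbb R^n)}$, and $\|u\|_{Y(\mathbb R^n)}=\||u|\|_{Y(\mathbb R^n)}$; (2) $0\le v\le u$ a.e. implies $\|v\|_{Y(\mathbb R^n)}\le\|u\|_{Y(\mathbb R^n)}$; (3) $0\le u_k\uparrow u$ a.e. implies $\|u_k\|_{Y(\mathbb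 R^n)}\uparrow\|u\|_{Y(\mathbb R^n)}$; (4) $|E|<\infty$ implies $\|\chi_E\|_{Y(\mathbb R^n)}<\infty$, where $\chi_E$ is the characteristic function of $E$; (5) $|E|<\infty$ implies $\int_E|u|\,dx\le C_E\|u\|_{Y(\mathbb R^n)}$ for some constant $C_E<\infty$ depending on $E$ but not on $u$; and such that $\|u\|_{Y(\mathbb R^n)}=\|v\|_{Y(\mathbb R^n)}$ whenever $u^*=v^*$, where $u^*(r)=\inf\{t\ge0:|\{|u|>t\}|\le r\}$, $r\ge 0$, is the decreasing rearrangement. The embedding $V^{s,A}_d(\mathbb R^n)\to Y(\mathbb R^n)$ is continuous: there is a constant $c$ with $\|u\|_{Y(\mathbb R^n)}\le c\,|\nabla^{[s]}u|_{\{s\},A,\mathbb R^n}$ for all $u\in V^{s,A}_d(\mathbb R^n)$.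
   Formalization: A Young function is required to be non-constant on (0,∞), excluding A(0)=0, A=∞ on (0,∞): for that A the space V^{s,A}_d is {0}, every embedding holds trivially, and the conclusion s<n fails (e.g. n=1, s=3/2). *)

theory Defs
  imports "HOL-Analysis.Analysis" "HOL-Library.Multiset"
begin

section \<open>Young functions\<close>

text \<open>
  A Young function \<open>[0,\<infinity>) \<rightarrow> [0,\<infinity>]\<close> is represented by a total function on \<open>real\<close> whose values
  at negative arguments are irrelevant.  ``Non-constant'' means non-constant on \<open>(0,\<infinity>)\<close>, i.e.
  neither identically \<open>0\<close> nor identically \<open>\<infinity>\<close> there: since \<open>A 0 = 0\<close>, non-constancy on \<open>[0,\<infinity>)\<close>
  would still admit the function equal to \<open>\<infinity>\<close> on all of \<open>(0,\<infinity>)\<close>, whose Orlicz--Sobolev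
  spaces contain only the zero function.
\<close>

definition young_function :: "(real \<Rightarrow> ennreal) \<Rightarrow> bool" where
  "young_function A \<longleftrightarrow>
     A 0 = 0 \<and>
     (\<forall>x\<ge>0. \<forall>y\<ge>0. \<forall>a\<ge>0. \<forall>b\<ge>0. a + b = 1 \<longrightarrow>
        A (a * x + b * y) \<le> ennreal a * A x + ennreal b * A y) \<and>
     (\<exists>x>0. \<exists>y>0. A x \<noteq> A y) \<and>
     (\<forall>t>0. (A \<longlongrightarrow> A t) (at_left t))"

text \<open>Used for exponents \<open>p > 0\<close> only.\<close>

definition ennreal_powr :: "ennreal \<Rightarrow> real \<Rightarrow> ennreal" where
  "ennreal_powr x p = (if x = \<infinity> then \<infinity> else ennreal (enn2real x powr p))"

definition integrable_near_0 :: "(real \<Rightarrow> ennreal) \<Rightarrow> bool" where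
  "integrable_near_0 f \<longleftrightarrow> (\<exists>\<delta>>0. (\<integral>\<^sup>+ t\<in>{0<..<\<delta>}. f t \<partial>lborel) < \<infinity>)"


section \<open>Weak derivatives\<close>

definition partial_deriv :: "'n \<Rightarrow> (real ^ 'n \<Rightarrow> real) \<Rightarrow> real ^ 'n \<Rightarrow> real" where
  "partial_deriv i f x = frechet_derivative f (at x) (axis i 1)"

text \<open>\<open>C\<^sub>c\<^sup>\<infinity>(\<real>\<^sup>n)\<close>: all iterated partial derivatives exist and are everywhere (Frechet) differentiable.\<close>

definition test_function :: "(real ^ 'n \<Rightarrow> real) \<Rightarrow> bool" where
  "test_function \<phi> \<longleftrightarrow>
     (\<forall>is x. foldr partial_deriv is \<phi> differentiable (at x)) \<and>
     compact (closure {x. \<phi> x \<noteq> 0})"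

text \<open>
  Multi-indices are multisets of coordinate directions: \<open>count \<alpha> i\<close> is the \<open>i\<close>-th entry of \<open>\<alpha>\<close> and
  \<open>size \<alpha>\<close> its order.  The index type carries no order, so an order of differentiation is chosen;
  for smooth functions the choice is immaterial.
\<close>

definition multi_deriv :: "'n multiset \<Rightarrow> (real ^ 'n \<Rightarrow> real) \<Rightarrow> real ^ 'n \<Rightarrow> real" where
  "multi_deriv \<alpha> \<phi> = foldr partial_deriv (SOME is. mset is = \<alpha>) \<phi>"

definition multi_indices :: "nat \<Rightarrow> 'n multiset set" where
  "multi_indices k = {\<alpha>. size \<alpha> = k}"

definition locally_integrable :: "(real ^ 'n \<Rightarrow> real) \<Rightarrow> bool" where
  "locally_integrable u \<longleftrightarrow> (\<forall>K. compact K \<longrightarrow> u absolutely_integrable_on K)"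

definition has_weak_deriv ::
    "(real ^ 'n \<Rightarrow> real) \<Rightarrow> 'n multiset \<Rightarrow> (real ^ 'n \<Rightarrow> real) \<Rightarrow> bool" where
  "has_weak_deriv u \<alpha> w \<longleftrightarrow>
     locally_integrable u \<and> locally_integrable w \<and>
     (\<forall>\<phi>. test_function \<phi> \<longrightarrow>
        (LINT x|lebesgue. u x * multi_deriv \<alpha> \<phi> x) =
        (-1) ^ size \<alpha> * (LINT x|lebesgue. w x * \<phi> x))"

text \<open>
  A representative of the weak derivative of order \<open>\<alpha>\<close>, which is unique up to null sets.
  The derivative of order \<open>0\<close> is \<open>u\<close> itself, for every measurable \<open>u\<close>; accordingly
  \<open>0\<close>-times weak differentiability imposes no local integrability.
\<close>

definition weak_deriv :: "(real ^ 'n \<Rightarrow> real) \<Rightarrow> 'n multiset \<Rightarrow> real ^ 'n \<Rightarrow> real" where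
  "weak_deriv u \<alpha> = (if \<alpha> = {#} then u else (SOME w. has_weak_deriv u \<alpha> w))"

definition weakly_differentiable :: "nat \<Rightarrow> (real ^ 'n \<Rightarrow> real) \<Rightarrow> bool" where
  "weakly_differentiable m u \<longleftrightarrow>
     (\<forall>\<alpha>. 1 \<le> size \<alpha> \<and> size \<alpha> \<le> m \<longrightarrow> (\<exists>w. has_weak_deriv u \<alpha> w))"

text \<open>\<open>\<nabla>\<^sup>k u\<close> is the vector of the \<open>weak_grad u x \<alpha>\<close> with \<open>\<alpha> \<in> multi_indices k\<close>.\<close>

definition weak_grad :: "(real ^ 'n \<Rightarrow> real) \<Rightarrow> real ^ 'n \<Rightarrow> 'n multiset \<Rightarrow> real" where
  "weak_grad u x \<alpha> = weak_deriv u \<alpha> x"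


section \<open>Fractional Orlicz--Sobolev spaces\<close>

text \<open>
  The dimension of the vector \<open>\<nabla>\<^sup>k u\<close> depends on \<open>k\<close>, so vector-valued functions are given by their
  components, indexed by a finite set \<open>I\<close>; \<open>L2_set _ I\<close> is the Euclidean norm.
\<close>

definition frac_modular ::
    "real \<Rightarrow> (real \<Rightarrow> ennreal) \<Rightarrow> 'i set \<Rightarrow> (real ^ 'n \<Rightarrow> 'i \<Rightarrow> real) \<Rightarrow> ennreal" where
  "frac_modular \<sigma> A I v =
     (\<integral>\<^sup>+ y. (\<integral>\<^sup>+ x.
        A (L2_set (\<lambda>i. v x i - v y i) I / norm (x - y) powr \<sigma>) / ennreal (norm (x - y) ^ CARD('n))
      \<partial>lebesgue) \<partial>lebesgue)"

definition frac_seminorm ::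
    "real \<Rightarrow> (real \<Rightarrow> ennreal) \<Rightarrow> 'i set \<Rightarrow> (real ^ 'n \<Rightarrow> 'i \<Rightarrow> real) \<Rightarrow> ennreal" where
  "frac_seminorm \<sigma> A I v =
     Inf (ennreal ` {r. r > 0 \<and> frac_modular \<sigma> A I (\<lambda>x i. v x i / r) \<le> 1})"

definition V_functional :: "real \<Rightarrow> (real \<Rightarrow> ennreal) \<Rightarrow> (real ^ 'n \<Rightarrow> real) \<Rightarrow> ennreal" where
  "V_functional s A u =
     frac_seminorm (frac s) A (multi_indices (nat \<lfloor>s\<rfloor>)) (weak_grad u)"

definition V_space :: "real \<Rightarrow> (real \<Rightarrow> ennreal) \<Rightarrow> (real ^ 'n \<Rightarrow> real) set" where
  "V_space s A =
     {u. u \<in> borel_measurable lebesgue \<and>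
         weakly_differentiable (nat \<lfloor>s\<rfloor>) u \<and>
         V_functional s A u < \<infinity> \<and>
         (\<forall>t>0. \<forall>k\<le>nat \<lfloor>s\<rfloor>.
            emeasure lebesgue {x. L2_set (weak_grad u x) (multi_indices k) > t} < \<infinity>)}"


section \<open>Rearrangement-invariant spaces\<close>

definition decr_rearrangement :: "(real ^ 'n \<Rightarrow> real) \<Rightarrow> real \<Rightarrow> ennreal" where
  "decr_rearrangement u r =
     Inf (ennreal ` {t. t \<ge> 0 \<and> emeasure lebesgue {x. \<bar>u x\<bar> > t} \<le> ennreal r})"

text \<open>
  A Banach function space \<open>{u. N u < \<infinity>}\<close> is given by its functional \<open>N\<close>.  Functions that agree
  almost everywhere have the same \<open>N\<close>, by the identity \<open>N u = N \<bar>u\<bar>\<close> and the lattice property.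
\<close>

definition banach_function_norm :: "((real ^ 'n \<Rightarrow> real) \<Rightarrow> ennreal) \<Rightarrow> bool" where
  "banach_function_norm N \<longleftrightarrow>
     (\<forall>u\<in>borel_measurable lebesgue. N u = 0 \<longleftrightarrow> (AE x in lebesgue. u x = 0)) \<and>
     (\<forall>u\<in>borel_measurable lebesgue. \<forall>c::real. N (\<lambda>x. c * u x) = ennreal \<bar>c\<bar> * N u) \<and>
     (\<forall>u\<in>borel_measurable lebesgue. \<forall>v\<in>borel_measurable lebesgue.
        N (\<lambda>x. u x + v x) \<le> N u + N v) \<and>
     (\<forall>u\<in>borel_measurable lebesgue. N u = N (\<lambda>x. \<bar>u x\<bar>)) \<and>
     (\<forall>u\<in>borel_measurable lebesgue. \<forall>v\<in>borel_measurable lebesgue.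
        (AE x in lebesgue. 0 \<le> v x \<and> v x \<le> u x) \<longrightarrow> N v \<le> N u) \<and>
     (\<forall>U u. (\<forall>k::nat. U k \<in> borel_measurable lebesgue) \<and> u \<in> borel_measurable lebesgue \<and>
        (AE x in lebesgue. (\<forall>k. 0 \<le> U k x) \<and> incseq (\<lambda>k. U k x) \<and> (\<lambda>k. U k x) \<longlonglongrightarrow> u x) \<longrightarrow>
        incseq (\<lambda>k. N (U k)) \<and> (\<lambda>k. N (U k)) \<longlonglongrightarrow> N u) \<and>
     (\<forall>E\<in>sets lebesgue. emeasure lebesgue E < \<infinity> \<longrightarrow> N (indicator E) < \<infinity>) \<and>
     (\<forall>E\<in>sets lebesgue. emeasure lebesgue E < \<infinity> \<longrightarrow>
        (\<exists>C::real. \<forall>u\<in>borel_measurable lebesgue.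
           (\<integral>\<^sup>+ x\<in>E. ennreal \<bar>u x\<bar> \<partial>lebesgue) \<le> ennreal C * N u))"

definition rearrangement_invariant_norm :: "((real ^ 'n \<Rightarrow> real) \<Rightarrow> ennreal) \<Rightarrow> bool" where
  "rearrangement_invariant_norm N \<longleftrightarrow>
     banach_function_norm N \<and>
     (\<forall>u\<in>borel_measurable lebesgue. \<forall>v\<in>borel_measurable lebesgue.
        (\<forall>r\<ge>0. decr_rearrangement u r = decr_rearrangement v r) \<longrightarrow> N u = N v)"

definition continuous_V_embedding ::
    "real \<Rightarrow> (real \<Rightarrow> ennreal) \<Rightarrow> ((real ^ 'n \<Rightarrow> real) \<Rightarrow> ennreal) \<Rightarrow> bool" where
  "continuous_V_embedding s A N \<longleftrightarrow>
     (\<exists>c::real. \<forall>u\<in>V_space s A. N u \<le> ennreal c * V_functional s A u)"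

end

theory Submission
  imports Defs "HOL-Computational_Algebra.Polynomial"
begin

text \<open>
  The embedding is tested on superpositions of dilates of one bump function,
  \<open>u(x) = \<Sum>\<^sub>k h\<^sub>k \<phi>(x / 2\<^sup>k)\<close> with \<open>h\<^sub>k = 2\<^sup>k\<^sup>s g\<^sub>k \<ge> 0\<close> and \<open>k = 0, 1, \<dots>, K - 1\<close>.  On the
  unit ball \<open>u\<close> is at least a constant times \<open>\<Sum>\<^sub>k 2\<^sup>k\<^sup>s g\<^sub>k\<close>, while the modular of its derivatives of
  order \<open>[s]\<close> is at most a constant times \<open>\<Sum>\<^sub>k 2\<^sup>k\<^sup>n A(c g\<^sub>k)\<close>
  (\<open>frac_modular_multiscale_bound\<close>).  For the latter, with \<open>\<sigma> = s - [s]\<close>, the scale \<open>k\<close> contributes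
  to the difference quotient at distance \<open>r\<close> a multiple of \<open>g\<^sub>k w(r / 2\<^sup>k)\<close> with
  \<open>w(\<rho>) = min (\<rho>\<^sup>1\<^sup>-\<^sup>\<sigma>) (\<rho>\<^sup>-\<^sup>\<sigma>)\<close>, and only if one of the two points lies in a ball of radius
  comparable to \<open>2\<^sup>k\<close>.  The sum \<open>\<Sum>\<^sub>k w(r / 2\<^sup>k)\<close> is bounded uniformly in \<open>r\<close>, so that Jensen's
  inequality moves \<open>A\<close> inside the sum over the scales, and the integral of \<open>w(|z| / 2\<^sup>k) |z|\<^sup>-\<^sup>n\<close> is
  bounded independently of \<open>k\<close>.

  Since a Banach function norm controls the integral over the unit ball, the embedding yields
  (\<open>embedding_imp_discrete_criterion\<close>) a constant \<open>C\<close> such that, for all nonnegative \<open>g\<close>,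
  \<open>\<Sum>\<^sub>k 2\<^sup>k\<^sup>s g\<^sub>k \<le> C (1 + \<Sum>\<^sub>k 2\<^sup>k\<^sup>n A(g\<^sub>k))\<close>.
  A single scale with \<open>g\<^sub>k\<close> proportional to \<open>2\<^sup>-\<^sup>k\<^sup>n\<close> gives \<open>s \<le> n\<close>, hence \<open>s < n\<close> because \<open>s\<close> is not
  an integer.  If \<open>g\<^sub>k\<close> is comparable to the largest \<open>t < 1\<close> with
  \<open>A(t) / t \<le> \<epsilon> 2\<^sup>-\<^sup>k\<^sup>(\<^sup>n\<^sup>-\<^sup>s\<^sup>)\<close>, then the right-hand side is at most
  \<open>C (1 + \<epsilon> \<Sum>\<^sub>k 2\<^sup>k\<^sup>s g\<^sub>k)\<close>; for small \<open>\<epsilon>\<close> the last sum is absorbed on the left, so that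
  \<open>\<Sum>\<^sub>k 2\<^sup>k\<^sup>s g\<^sub>k\<close> converges.  Decomposing \<open>(0,1)\<close> into the level sets of \<open>A(t) / t\<close> bounds the
  integral of \<open>(t / A(t))\<^sup>s\<^sup>/\<^sup>(\<^sup>n\<^sup>-\<^sup>s\<^sup>)\<close> by a constant plus a multiple of this sum.

  The space consists of weakly differentiable functions, so one must also know that the weak
  derivatives of a test function are its classical ones: integration by parts gives one weak
  derivative, and the uniqueness of weak derivatives (\<open>AE_eq_if_test_integrals_eq\<close>) identifies it
  almost everywhere with the chosen one.
\<close>

section \<open>Young functions\<close>

lemma young_zero: "young_function A \<Longrightarrow> A 0 = 0"
  by (simp add: young_function_def)

lemma young_scale:
  assumes "young_function A" "0 \<le> a" "a \<le> 1" "0 \<le> x"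
  shows "A (a * x) \<le> ennreal a * A x"
proof -
  have conv: "\<And>x y a b. \<lbrakk>0 \<le> x; 0 \<le> y; 0 \<le> a; 0 \<le> b; a + b = 1\<rbrakk> \<Longrightarrow>
      A (a * x + b * y) \<le> ennreal a * A x + ennreal b * A y"
    using assms(1) unfolding young_function_def by blast
  from conv[of x 0 a "1 - a"] show ?thesis using assms by (simp add: young_zero)
qed

lemma young_mono:
  assumes A: "young_function A" and "0 \<le> x" "x \<le> y"
  shows "A x \<le> A y"
proof (cases "y = 0")
  case True then show ?thesis using assms by simp
next
  case False
  then have y: "0 < y" using assms by simp
  have "A (x / y * y) \<le> ennreal (x / y) * A y"
    using assms y by (intro young_scale) auto
  also have "\<dots> \<le> ennreal 1 * A y"
    using assms y by (intro mult_right_mono ennreal_leI) auto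
  finally show ?thesis using y by simp
qed

text \<open>
  Convexity does not exclude that \<open>A\<close> is infinite on \<open>(0,\<infinity>)\<close>; non-constancy there does.
\<close>

lemma young_finite_somewhere:
  assumes A: "young_function A"
  obtains t0 where "0 < t0" "A t0 < \<infinity>"
proof -
  obtain x y where "x > 0" "y > 0" "A x \<noteq> A y"
    using A unfolding young_function_def by blast
  then show ?thesis using that by (metis infinity_ennreal_def less_top)
qed

text \<open>
  The weights need not add up to \<open>1\<close>, since the missing mass can be put on \<open>A 0 = 0\<close>.
\<close>

lemma young_jensen:
  assumes A: "young_function A" and "finite S"
    and "\<And>k. k \<in> S \<Longrightarrow> 0 \<le> c k" "sum c S \<le> 1" "\<And>k. k \<in> S \<Longrightarrow> 0 \<le> x k"
  shows "A (\<Sum>k\<in>S. c k * x k) \<le> (\<Sum>k\<in>S. ennreal (c k) * A (x k))"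
  using assms(2-)
proof (induction S arbitrary: c rule: finite_induct)
  case empty
  then show ?case using A by (simp add: young_zero)
next
  case (insert j S)
  have conv: "\<And>x y a b. \<lbrakk>0 \<le> x; 0 \<le> y; 0 \<le> a; 0 \<le> b; a + b = 1\<rbrakk> \<Longrightarrow>
      A (a * x + b * y) \<le> ennreal a * A x + ennreal b * A y"
    using A unfolding young_function_def by blast
  define \<mu> where "\<mu> = 1 - c j"
  have sum0: "0 \<le> sum c S" using insert by (intro sum_nonneg) auto
  have le\<mu>: "sum c S \<le> \<mu>" using insert by (simp add: \<mu>_def)
  show ?case
  proof (cases "\<mu> = 0")
    case True
    then have "sum c S = 0" using sum0 le\<mu> by simp
    then have z: "\<forall>k\<in>S. c k = 0" using insert by (subst (asm) sum_nonneg_eq_0_iff) auto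
    have "c j = 1" using True \<mu>_def by simp
    then show ?thesis using z insert by simp
  next
    case False
    then have \<mu>: "0 < \<mu>" using sum0 le\<mu> by simp
    let ?y = "\<Sum>k\<in>S. (c k / \<mu>) * x k"
    have y0: "0 \<le> ?y" using insert \<mu> by (intro sum_nonneg mult_nonneg_nonneg divide_nonneg_pos) auto
    have IH: "A ?y \<le> (\<Sum>k\<in>S. ennreal (c k / \<mu>) * A (x k))"
      using insert \<mu> le\<mu> by (intro insert.IH) (auto simp: sum_divide_distrib[symmetric])
    have "(\<Sum>k\<in>insert j S. c k * x k) = c j * x j + \<mu> * ?y"
      using insert \<mu> by (simp add: sum_distrib_left)
    then have "A (\<Sum>k\<in>insert j S. c k * x k) \<le> ennreal (c j) * A (x j) + ennreal \<mu> * A ?y"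
      using conv[of "x j" ?y "c j" \<mu>] insert \<mu> y0 by (auto simp: \<mu>_def)
    also have "\<dots> \<le> ennreal (c j) * A (x j) + ennreal \<mu> * (\<Sum>k\<in>S. ennreal (c k / \<mu>) * A (x k))"
      by (intro add_left_mono mult_left_mono IH) auto
    also have "ennreal \<mu> * (\<Sum>k\<in>S. ennreal (c k / \<mu>) * A (x k)) = (\<Sum>k\<in>S. ennreal (c k) * A (x k))"
      unfolding sum_distrib_left
    proof (rule sum.cong[OF refl])
      fix k assume "k \<in> S"
      then have "ennreal \<mu> * ennreal (c k / \<mu>) = ennreal (c k)"
        using \<mu> insert by (simp add: ennreal_mult[symmetric])
      then show "ennreal \<mu> * (ennreal (c k / \<mu>) * A (x k)) = ennreal (c k) * A (x k)"
        by (metis mult.assoc)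
    qed
    finally show ?thesis using insert by simp
  qed
qed

section \<open>The discrete criterion\<close>

lemma ennreal_le_suminf_term: "f k \<le> (\<Sum>k. f k)" for f :: "nat \<Rightarrow> ennreal"
  using sum_le_suminf[of f "{k}"] by simp

text \<open>
  Only one \<open>g\<^sub>k\<close> is nonzero: it is \<open>t\<^sub>0 / 2\<^sup>k\<^sup>n\<close>, where \<open>A t\<^sub>0\<close> is finite.  By convexity
  \<open>2\<^sup>k\<^sup>n A(g\<^sub>k) \<le> A t\<^sub>0\<close>, whereas \<open>2\<^sup>k\<^sup>s g\<^sub>k\<close> is unbounded in \<open>k\<close> if \<open>s > n\<close>.
\<close>

lemma discrete_criterion_imp_less:
  fixes s :: real and n :: nat and C :: real
  assumes A: "young_function A" and s: "0 < s" "s \<noteq> real n" and C: "0 \<le> C"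
    and crit: "\<And>(K::nat) g. (\<And>k. 0 \<le> g k) \<Longrightarrow>
      (\<Sum>k<K. ennreal (2 powr (s * real k) * g k))
        \<le> ennreal C * (1 + (\<Sum>k<K. ennreal (2 ^ (k * n)) * A (g k)))"
  shows "s < real n"
proof (rule ccontr)
  assume "\<not> s < real n"
  then have sn: "s > real n" using s by simp
  obtain t0 where t0: "0 < t0" "A t0 < \<infinity>" using young_finite_somewhere[OF A] .
  obtain a where a: "A t0 = ennreal a" "0 \<le> a" using t0(2)
    by (cases "A t0") auto
  have bound: "2 powr (s * real k) * (t0 / 2 ^ (k * n)) \<le> C * (1 + a)" for k
  proof -
    define g where "g = (\<lambda>j. if j = k then t0 / 2 ^ (k * n) else 0)"
    have g0: "0 \<le> g j" for j using t0 by (simp add: g_def)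
    have Ag: "A (g k) \<le> ennreal (1 / 2 ^ (k * n)) * A t0"
      using young_scale[OF A, of "1 / 2 ^ (k * n)" t0] t0 by (simp add: g_def)
    have "ennreal (2 powr (s * real k) * g k) \<le> (\<Sum>j<Suc k. ennreal (2 powr (s * real j) * g j))"
      by (simp del: ennreal_eq_0_iff)
    also have "\<dots> \<le> ennreal C * (1 + (\<Sum>j<Suc k. ennreal (2 ^ (j * n)) * A (g j)))"
      by (rule crit[OF g0])
    also have "(\<Sum>j<Suc k. ennreal (2 ^ (j * n)) * A (g j)) = ennreal (2 ^ (k * n)) * A (g k)"
      using A by (simp add: g_def young_zero)
    also have "\<dots> \<le> ennreal (2 ^ (k * n)) * (ennreal (1 / 2 ^ (k * n)) * A t0)"
      by (intro mult_left_mono Ag) auto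
    also have "\<dots> = ennreal a"
      unfolding a(1) using a(2) by (simp add: ennreal_mult[symmetric])
    finally have "ennreal (2 powr (s * real k) * g k) \<le> ennreal C * (1 + ennreal a)"
      by (simp add: mult_left_mono)
    also have "\<dots> = ennreal (C * (1 + a))"
      using C a(2) by (simp add: ennreal_mult ennreal_plus)
    finally show ?thesis using C a(2) by (simp add: g_def)
  qed
  have eq: "2 powr (s * real k) * (t0 / 2 ^ (k * n)) = t0 * (2 powr (s - real n)) ^ k" for k
  proof -
    have "(2::real) ^ (k * n) = 2 powr (real n * real k)"
      by (simp add: powr_realpow[symmetric] mult.commute)
    moreover have "(2 powr (s - real n)) ^ k = 2 powr (s * real k - real n * real k)"
      by (simp add: powr_realpow[symmetric] powr_powr left_diff_distrib)
    ultimately show ?thesis by (simp add: powr_diff)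
  qed
  have "1 < 2 powr (s - real n)" using sn by simp
  then obtain k where "C * (1 + a) / t0 < (2 powr (s - real n)) ^ k"
    using real_arch_pow by blast
  then show False using bound[of k] t0 unfolding eq by (simp add: field_simps)
qed

text \<open>
  \<open>G\<^sub>k\<close> is the supremum of the set of \<open>t < 1\<close> with \<open>A(t) / t \<le> \<tau>\<^sub>k\<close>, where
  \<open>\<tau>\<^sub>k = \<epsilon> 2\<^sup>-\<^sup>k\<^sup>(\<^sup>n\<^sup>-\<^sup>s\<^sup>)\<close>.  The criterion is applied to \<open>g\<^sub>k = G\<^sub>k / 2\<close>, which belongs to this set
  unless \<open>G\<^sub>k = 0\<close>; the factor \<open>1/2\<close> avoids any use of the continuity of \<open>A\<close>.
\<close>

lemma discrete_criterion_imp_integrable: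
  fixes s :: real and n :: nat and C :: real
  assumes A: "young_function A" and s: "0 < s" "s < real n" and C: "0 \<le> C"
    and crit: "\<And>(K::nat) g. (\<And>k. 0 \<le> g k) \<Longrightarrow>
      (\<Sum>k<K. ennreal (2 powr (s * real k) * g k))
        \<le> ennreal C * (1 + (\<Sum>k<K. ennreal (2 ^ (k * n)) * A (g k)))"
  shows "integrable_near_0 (\<lambda>t. ennreal_powr (ennreal t / A t) (s / (real n - s)))"
proof -
  define p where "p = s / (real n - s)"
  have p: "0 < p" using s by (simp add: p_def)
  define \<epsilon> where "\<epsilon> = 1 / (2 * (C + 1))"
  have \<epsilon>: "0 < \<epsilon>" "C * \<epsilon> \<le> 1/2" using C by (auto simp: \<epsilon>_def field_simps)
  define \<tau> where "\<tau> k = \<epsilon> * 2 powr (- (real n - s) * real k)" for k :: nat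
  have \<tau>: "0 < \<tau> k" for k using \<epsilon> by (simp add: \<tau>_def)
  have \<tau>_pow: "\<tau> k powr (-p) = \<epsilon> powr (-p) * 2 powr (s * real k)" for k
  proof -
    have "- (real n - s) * real k * - p = s * real k"
      using s by (simp add: p_def field_simps)
    then show ?thesis using \<epsilon> by (simp add: \<tau>_def powr_mult powr_powr)
  qed
  have n\<tau>: "2 ^ (k * n) * \<tau> k = \<epsilon> * 2 powr (s * real k)" for k
  proof -
    have "(2::real) ^ (k * n) = 2 powr (real n * real k)"
      by (simp add: powr_realpow[symmetric] mult.commute)
    then show ?thesis by (simp add: \<tau>_def powr_add[symmetric] algebra_simps)
  qed
  define T where "T k = {t. 0 < t \<and> t < 1 \<and> A t \<le> ennreal (\<tau> k * t)}" for k
  define G where "G k = Sup (insert 0 (T k))" for k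
  have bdd: "bdd_above (insert 0 (T k))" for k
    by (rule bdd_aboveI[of _ 1]) (auto simp: T_def)
  have G0: "0 \<le> G k" for k unfolding G_def by (rule cSup_upper[OF _ bdd]) simp
  have TG: "t \<le> G k" if "t \<in> T k" for t k
    unfolding G_def by (rule cSup_upper[OF _ bdd]) (use that in simp)
  have AG: "A (G k / 2) \<le> ennreal (\<tau> k * (G k / 2))" for k
  proof (cases "G k = 0")
    case True then show ?thesis using young_zero[OF A] by simp
  next
    case False
    then have Gp: "0 < G k" "G k / 2 < G k" using G0[of k] by auto
    then obtain t where t: "t \<in> insert 0 (T k)" "G k / 2 < t"
      unfolding G_def using less_cSup_iff[OF _ bdd, of k] by (metis insert_not_empty)
    have tT: "t \<in> T k" "0 < t" using t Gp by auto
    have r: "0 \<le> G k / 2 / t" "G k / 2 / t \<le> 1" using t Gp tT by auto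
    have "A (G k / 2) = A (G k / 2 / t * t)" using tT by simp
    also have "\<dots> \<le> ennreal (G k / 2 / t) * A t"
      using r tT by (intro young_scale[OF A]) auto
    also have "\<dots> \<le> ennreal (G k / 2 / t) * ennreal (\<tau> k * t)"
      using tT by (intro mult_left_mono) (auto simp: T_def)
    also have "\<dots> = ennreal (\<tau> k * (G k / 2))"
      using r tT \<tau>[of k] by (simp add: ennreal_mult[symmetric] mult.commute)
    finally show ?thesis .
  qed
  \<comment> \<open>\<open>C \<epsilon> \<le> 1/2\<close> allows the sum on the right-hand side of the criterion to be absorbed.\<close>
  have sumG: "(\<Sum>k<K. 2 powr (s * real k) * G k) \<le> 4 * C" for K :: nat
  proof -
    define S where "S = (\<Sum>k<K. 2 powr (s * real k) * (G k / 2))"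
    have S0: "0 \<le> S" unfolding S_def using G0 by (intro sum_nonneg) auto
    have "ennreal S = (\<Sum>k<K. ennreal (2 powr (s * real k) * (G k / 2)))"
      unfolding S_def using G0 by (subst sum_ennreal) auto
    also have "\<dots> \<le> ennreal C * (1 + (\<Sum>k<K. ennreal (2 ^ (k * n)) * A (G k / 2)))"
      by (rule crit) (use G0 in auto)
    also have "\<dots> \<le> ennreal C * (1 + ennreal (\<epsilon> * S))"
    proof -
      have "(\<Sum>k<K. ennreal (2 ^ (k * n)) * A (G k / 2))
          \<le> (\<Sum>k<K. ennreal (2 ^ (k * n)) * ennreal (\<tau> k * (G k / 2)))"
        by (intro sum_mono mult_left_mono AG) auto
      also have "\<dots> = (\<Sum>k<K. ennreal (\<epsilon> * (2 powr (s * real k) * (G k / 2))))"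
      proof (rule sum.cong[OF refl])
        fix k
        have "ennreal (2 ^ (k * n)) * ennreal (\<tau> k * (G k / 2)) = ennreal ((2 ^ (k * n) * \<tau> k) * (G k / 2))"
          using \<tau>[of k] G0[of k] by (simp add: ennreal_mult[symmetric] mult.assoc)
        then show "ennreal (2 ^ (k * n)) * ennreal (\<tau> k * (G k / 2))
            = ennreal (\<epsilon> * (2 powr (s * real k) * (G k / 2)))"
          by (simp only: n\<tau> mult.assoc)
      qed
      also have "\<dots> = ennreal (\<epsilon> * S)"
        unfolding S_def sum_distrib_left using G0 \<epsilon> by (intro sum_ennreal) auto
      finally show ?thesis by (intro mult_left_mono add_left_mono) auto
    qed
    also have "\<dots> = ennreal (C * (1 + \<epsilon> * S))"
      using C \<epsilon> S0 by (simp add: ennreal_mult ennreal_plus)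
    finally have "S \<le> C * (1 + \<epsilon> * S)" using C \<epsilon> S0 by simp
    also have "\<dots> = C + (C * \<epsilon>) * S" by (simp add: algebra_simps)
    also have "\<dots> \<le> C + (1/2) * S" by (intro add_left_mono mult_right_mono \<epsilon> S0)
    finally have "S \<le> 2 * C" by simp
    moreover have "(\<Sum>k<K. 2 powr (s * real k) * G k) = 2 * S"
      unfolding S_def by (simp add: sum_distrib_left)
    ultimately show ?thesis by simp
  qed
  \<comment> \<open>On the level set \<open>\<tau>\<^sub>k\<^sub>+\<^sub>1 < A(t) / t \<le> \<tau>\<^sub>k\<close>, which is contained in \<open>(0, G\<^sub>k]\<close>, the integrand is at
    most \<open>\<tau>\<^sub>k\<^sub>+\<^sub>1\<^sup>-\<^sup>p\<close>, a multiple of \<open>2\<^sup>k\<^sup>s\<close>.\<close>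
  define F where "F t = ennreal (\<tau> 0 powr (-p)) * indicator {0<..<1} t +
      (\<Sum>k. ennreal (\<epsilon> powr (-p) * 2 powr s * 2 powr (s * real k)) * indicator {0<..G k} t)"
    for t :: real
  have dom: "ennreal_powr (ennreal t / A t) p * indicator {0<..<1} t \<le> F t" for t
  proof (cases "0 < t \<and> t < 1")
    case False then show ?thesis by auto
  next
    case True
    then have t: "0 < t" "t < 1" by auto
    show ?thesis
    proof (cases "A t = \<infinity>")
      case True
      then show ?thesis using p by (simp add: ennreal_powr_def)
    next
      case False
      then obtain a where a: "A t = ennreal a" "0 \<le> a" by (cases "A t") auto
      \<comment> \<open>If \<open>A t = 0\<close>, then \<open>G\<^sub>k \<ge> t\<close> for all \<open>k\<close>, which contradicts the bound on the sum.\<close>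
      have apos: "a \<noteq> 0"
      proof
        assume "a = 0"
        then have "t \<in> T k" for k using t a \<tau>[of k] by (simp add: T_def)
        then have tG: "t \<le> G k" for k using TG by blast
        have "2 powr s > 1" using s by simp
        then obtain k where k: "4 * C / t < (2 powr s) ^ k" using real_arch_pow by blast
        then have "4 * C < 2 powr (s * real k) * t"
          using t by (simp add: powr_realpow[symmetric] powr_powr field_simps)
        also have "\<dots> \<le> 2 powr (s * real k) * G k" using tG by simp
        also have "\<dots> \<le> (\<Sum>k<Suc k. 2 powr (s * real k) * G k)"
          by (rule member_le_sum) (use G0 in auto)
        also have "\<dots> \<le> 4 * C" by (rule sumG)
        finally show False by simp
      qed
      then have a0: "0 < a" using a by simp
      have val: "ennreal_powr (ennreal t / A t) p = ennreal ((a / t) powr (-p))"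
        using t a0 a by (simp add: ennreal_powr_def divide_ennreal powr_minus powr_divide)
      show ?thesis
      proof (cases "a / t > \<tau> 0")
        case True
        have "(a / t) powr (-p) \<le> \<tau> 0 powr (-p)"
          using True \<tau>[of 0] p by (intro powr_mono2') auto
        then show ?thesis unfolding val F_def using t
          by (auto intro!: add_increasing2 ennreal_leI)
      next
        case False
        have "2 powr (- (real n - s)) < 1" using s by (simp add: powr_less_one)
        then obtain k0 where "(2 powr (- (real n - s))) ^ k0 < a / t / \<epsilon>"
          using real_arch_pow_inv[of "a / t / \<epsilon>"] a0 t \<epsilon> by auto
        moreover have "\<tau> k0 = \<epsilon> * (2 powr (- (real n - s))) ^ k0"
          by (simp add: \<tau>_def powr_realpow[symmetric] powr_powr)
        ultimately have "\<tau> k0 < a / t" using \<epsilon> t by (simp add: field_simps)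
        then have ex: "\<exists>k. \<tau> k < a / t" by blast
        define j where "j = (LEAST k. \<tau> k < a / t)"
        have j: "\<tau> j < a / t" using LeastI_ex[OF ex] j_def by simp
        have "j \<noteq> 0" using j False by (intro notI) simp
        then obtain k where jk: "j = Suc k" by (cases j) auto
        have "\<not> \<tau> k < a / t" using not_less_Least[of k "\<lambda>k. \<tau> k < a / t"] jk j_def by simp
        then have "t \<in> T k" using t a by (simp add: T_def field_simps)
        then have tG: "t \<le> G k" by (rule TG)
        have "(a / t) powr (-p) \<le> \<tau> (Suc k) powr (-p)"
          using j jk \<tau>[of j] p by (intro powr_mono2') auto
        also have "\<dots> = \<epsilon> powr (-p) * 2 powr s * 2 powr (s * real k)"
          unfolding \<tau>_pow by (simp add: powr_add[symmetric] algebra_simps)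
        finally have *: "ennreal ((a / t) powr (-p))
            \<le> ennreal (\<epsilon> powr (-p) * 2 powr s * 2 powr (s * real k)) * indicator {0<..G k} t"
          using t tG by (simp add: ennreal_leI)
        also have "\<dots> \<le> (\<Sum>k. ennreal (\<epsilon> powr (-p) * 2 powr s * 2 powr (s * real k)) * indicator {0<..G k} t)"
          by (rule ennreal_le_suminf_term)
        finally show ?thesis unfolding val F_def using t by (simp add: add_increasing)
      qed
    qed
  qed
  have "(\<integral>\<^sup>+ t\<in>{0<..<1}. ennreal_powr (ennreal t / A t) p \<partial>lborel) \<le> (\<integral>\<^sup>+ t. F t \<partial>lborel)"
    by (intro nn_integral_mono dom)
  also have "\<dots> = ennreal (\<tau> 0 powr (-p)) +
      (\<Sum>k. ennreal (\<epsilon> powr (-p) * 2 powr s * 2 powr (s * real k)) * ennreal (G k))"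
    unfolding F_def using G0
    by (subst nn_integral_add; (subst nn_integral_suminf)?) (auto simp: nn_integral_cmult_indicator)
  also have "\<dots> \<le> ennreal (\<tau> 0 powr (-p)) + ennreal (\<epsilon> powr (-p) * 2 powr s * (4 * C))"
  proof (intro add_left_mono)
    have "(\<Sum>k<K. ennreal (\<epsilon> powr (-p) * 2 powr s * 2 powr (s * real k)) * ennreal (G k))
       \<le> ennreal (\<epsilon> powr (-p) * 2 powr s * (4 * C))" for K
    proof -
      have "(\<Sum>k<K. ennreal (\<epsilon> powr (-p) * 2 powr s * 2 powr (s * real k)) * ennreal (G k))
         = (\<Sum>k<K. ennreal (\<epsilon> powr (-p) * 2 powr s * (2 powr (s * real k) * G k)))"
        using G0 by (intro sum.cong refl) (simp add: ennreal_mult[symmetric] mult.assoc)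
      also have "\<dots> = ennreal (\<epsilon> powr (-p) * 2 powr s * (\<Sum>k<K. 2 powr (s * real k) * G k))"
        unfolding sum_distrib_left using G0 by (intro sum_ennreal) auto
      also have "\<dots> \<le> ennreal (\<epsilon> powr (-p) * 2 powr s * (4 * C))"
        by (intro ennreal_leI mult_left_mono sumG) auto
      finally show ?thesis .
    qed
    then show "(\<Sum>k. ennreal (\<epsilon> powr (-p) * 2 powr s * 2 powr (s * real k)) * ennreal (G k))
       \<le> ennreal (\<epsilon> powr (-p) * 2 powr s * (4 * C))"
      by (intro suminf_le_const) auto
  qed
  also have "\<dots> < \<infinity>" by simp
  finally show ?thesis unfolding integrable_near_0_def p_def by (intro exI[of _ 1]) simp
qed

section \<open>Calculus of test functions\<close>

lemma partial_deriv_eqI: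
  "(f has_derivative f') (at x) \<Longrightarrow> partial_deriv i f x = f' (axis i 1)"
  unfolding partial_deriv_def by (metis frechet_derivative_at)

lemma test_function_differentiable: "test_function f \<Longrightarrow> f differentiable (at x)"
  unfolding test_function_def by (metis foldr.simps(1) id_apply)

lemma test_function_continuous: "test_function f \<Longrightarrow> continuous_on S f"
  by (intro continuous_at_imp_continuous_on ballI differentiable_imp_continuous_within
      test_function_differentiable)

lemma test_function_measurable: "test_function f \<Longrightarrow> f \<in> borel_measurable borel"
  by (intro borel_measurable_continuous_onI test_function_continuous)

lemma test_function_support:
  fixes f :: "real ^ 'n \<Rightarrow> real"
  assumes "test_function f"
  obtains R where "0 < R" "\<And>x. R < norm x \<Longrightarrow> f x = 0"
proof -
  have "bounded (closure {x. f x \<noteq> 0})"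
    using assms by (auto simp: test_function_def compact_imp_bounded)
  then obtain R where R: "0 < R" "\<And>x. x \<in> closure {x. f x \<noteq> 0} \<Longrightarrow> norm x \<le> R"
    unfolding bounded_pos by auto
  show ?thesis
    by (rule that[of R]) (use R closure_subset[of "{x. f x \<noteq> 0}"] in force)+
qed

lemma test_functionI:
  fixes f :: "real ^ 'n \<Rightarrow> real"
  assumes "\<And>is x. foldr partial_deriv is f differentiable (at x)"
    and "\<And>x. R < norm x \<Longrightarrow> f x = 0"
  shows "test_function f"
proof -
  have "{x. f x \<noteq> 0} \<subseteq> cball 0 R" using assms(2) by (auto simp: not_less[symmetric])
  then have "compact (closure {x. f x \<noteq> 0})"
    using bounded_subset[OF bounded_cball] compact_closure by blast
  then show ?thesis using assms(1) by (simp add: test_function_def)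
qed

lemma test_function_partial_deriv:
  fixes f :: "real ^ 'n \<Rightarrow> real"
  assumes f: "test_function f"
  shows "test_function (partial_deriv i f)"
proof -
  obtain R where R: "0 < R" "\<And>x. R < norm x \<Longrightarrow> f x = 0" by (rule test_function_support[OF f], rule that)
  have "foldr partial_deriv is (partial_deriv i f) differentiable (at x)" for "is" x
  proof -
    have "foldr partial_deriv (is @ [i]) f differentiable (at x)"
      using f unfolding test_function_def by blast
    then show ?thesis by simp
  qed
  moreover have "partial_deriv i f x = 0" if "R < norm x" for x
  proof -
    have op: "open {y::real^'n. R < norm y}" by (intro open_Collect_less continuous_intros)
    have "((\<lambda>_. 0) has_derivative (\<lambda>_. 0)) (at x)" by simp
    then have "(f has_derivative (\<lambda>_. 0)) (at x)"
      by (rule has_derivative_transform_within_open[OF _ op]) (use that R in auto)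
    then show ?thesis by (simp add: partial_deriv_eqI)
  qed
  ultimately show ?thesis by (rule test_functionI)
qed

lemma test_function_foldr:
  "test_function f \<Longrightarrow> test_function (foldr partial_deriv is f)"
  by (induction "is") (auto intro: test_function_partial_deriv)

lemma test_function_bounded:
  fixes f :: "real ^ 'n \<Rightarrow> real"
  assumes f: "test_function f"
  obtains M where "0 < M" "\<And>x. \<bar>f x\<bar> \<le> M"
proof -
  obtain R where R: "0 < R" "\<And>x. R < norm x \<Longrightarrow> f x = 0" by (rule test_function_support[OF f], rule that)
  have "bounded (f ` cball 0 R)"
    by (intro compact_imp_bounded compact_continuous_image test_function_continuous f compact_cball)
  then obtain M where M: "0 < M" "\<And>x. x \<in> cball 0 R \<Longrightarrow> \<bar>f x\<bar> \<le> M"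
    unfolding bounded_pos by auto
  show ?thesis
  proof (rule that[of M])
    show "\<bar>f x\<bar> \<le> M" for x using M R(2)[of x] by (cases "norm x \<le> R") auto
  qed (rule M)
qed

lemma test_function_integrable:
  fixes f :: "real ^ 'n \<Rightarrow> real"
  assumes f: "test_function f"
  shows "integrable lborel f"
proof -
  obtain R where R: "0 < R" "\<And>x. R < norm x \<Longrightarrow> f x = 0" by (rule test_function_support[OF f], rule that)
  have "integrable lborel (\<lambda>x. indicator (cball 0 R) x *\<^sub>R f x)"
    by (intro borel_integrable_compact compact_cball test_function_continuous f)
  also have "(\<lambda>x. indicator (cball 0 R) x *\<^sub>R f x) = f"
    using R by (auto simp: indicator_def fun_eq_iff)
  finally show ?thesis .
qed

lemma test_function_lipschitz:
  fixes f :: "real ^ 'n \<Rightarrow> real"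
  assumes f: "test_function f"
  obtains L where "0 < L" "\<And>x y. \<bar>f x - f y\<bar> \<le> L * norm (x - y)"
proof -
  have "\<exists>M. 0 < M \<and> (\<forall>x. \<bar>partial_deriv i f x\<bar> \<le> M)" for i
    using test_function_bounded[OF test_function_partial_deriv[OF f]] by metis
  then obtain M where M: "\<And>i. 0 < M i" "\<And>i x. \<bar>partial_deriv i f x\<bar> \<le> M i" by metis
  let ?L = "\<Sum>i\<in>UNIV. M i"
  have L: "0 < ?L" by (intro sum_pos) (auto simp: M)
  have *: "norm (f x - f y) \<le> ?L * norm (x - y)" for x y
  proof (rule differentiable_bound[of UNIV f "\<lambda>x. frechet_derivative f (at x)"])
    fix z :: "real ^ 'n"
    have D: "(f has_derivative frechet_derivative f (at z)) (at z)"
      using test_function_differentiable[OF f] by (simp add: frechet_derivative_works)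
    then show "(f has_derivative frechet_derivative f (at z)) (at z within UNIV)" by simp
    interpret bounded_linear "frechet_derivative f (at z)" using D by (rule has_derivative_bounded_linear)
    show "onorm (frechet_derivative f (at z)) \<le> ?L"
    proof (rule onorm_le)
      fix v :: "real ^ 'n"
      have "v = (\<Sum>i\<in>UNIV. v $ i *\<^sub>R axis i 1)"
        using basis_expansion[of v] by (simp add: scalar_mult_eq_scaleR)
      then have "frechet_derivative f (at z) v = frechet_derivative f (at z) (\<Sum>i\<in>UNIV. v $ i *\<^sub>R axis i 1)"
        by (rule arg_cong)
      also have "\<dots> = (\<Sum>i\<in>UNIV. v $ i * partial_deriv i f z)"
        by (simp add: sum scaleR partial_deriv_def)
      also have "norm \<dots> \<le> (\<Sum>i\<in>UNIV. norm v * M i)"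
        by (intro sum_norm_le) (auto simp: norm_mult abs_mult intro!: mult_mono M component_le_norm_cart)
      finally show "norm (frechet_derivative f (at z) v) \<le> ?L * norm v"
        by (simp add: sum_distrib_left mult.commute)
    qed
  qed auto
  show ?thesis by (rule that[OF L]) (use * in \<open>simp only: real_norm_def\<close>)
qed

lemma has_real_derivative_along_axis:
  fixes F :: "real ^ 'n \<Rightarrow> real"
  assumes "\<And>x. F differentiable (at x)"
  shows "((\<lambda>t. F (x + t *\<^sub>R axis i 1)) has_real_derivative partial_deriv i F (x + t *\<^sub>R axis i 1)) (at t)"
proof -
  let ?p = "x + t *\<^sub>R axis i (1::real)"
  have D: "(F has_derivative frechet_derivative F (at ?p)) (at ?p)"
    using assms by (simp add: frechet_derivative_works)
  interpret bounded_linear "frechet_derivative F (at ?p)" using D by (rule has_derivative_bounded_linear)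
  have "((\<lambda>t. x + t *\<^sub>R axis i 1) has_derivative (\<lambda>h. h *\<^sub>R axis i 1)) (at t)"
    by (auto intro!: derivative_eq_intros)
  from diff_chain_at[OF this D] show ?thesis
    by (simp add: has_field_derivative_def o_def scaleR partial_deriv_def mult_commute_abs)
qed

text \<open>
  The integral of a difference quotient vanishes by translation invariance of Lebesgue measure;
  the difference quotients are dominated by a multiple of the indicator of a ball.
\<close>

lemma integral_partial_deriv_eq_0:
  fixes F :: "real ^ 'n \<Rightarrow> real"
  assumes diff: "\<And>x. F differentiable (at x)"
    and cont: "continuous_on UNIV (partial_deriv i F)"
    and supp: "\<And>x. R < norm x \<Longrightarrow> F x = 0"
    and int: "integrable lborel F"
    and bd: "\<And>x. \<bar>partial_deriv i F x\<bar> \<le> M"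
  shows "(LINT x|lborel. partial_deriv i F x) = 0"
proof -
  define h where "h j = inverse (real (Suc j))" for j
  have h: "0 < h j" "h j \<le> 1" for j by (auto simp: h_def field_simps)
  define q where "q j x = (F (x + h j *\<^sub>R axis i 1) - F x) / h j" for j x
  have Fm [measurable]: "F \<in> borel_measurable borel" using int by simp
  have trans: "integrable lborel (\<lambda>x. F (x + c))" "(LINT x|lborel. F (x + c)) = (LINT x|lborel. F x)" for c
  proof -
    have "integrable (distr lborel borel ((+) c)) F" by (simp add: lborel_distr_plus int)
    then show "integrable lborel (\<lambda>x. F (x + c))"
      by (subst (asm) integrable_distr_eq) (auto simp: add.commute)
    have "(LINT x|distr lborel borel ((+) c). F x) = (LINT x|lborel. F (x + c))"
      by (subst integral_distr) (auto simp: add.commute)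
    then show "(LINT x|lborel. F (x + c)) = (LINT x|lborel. F x)" by (simp add: lborel_distr_plus)
  qed
  have q0: "(LINT x|lborel. q j x) = 0" for j
    unfolding q_def using trans int by simp
  have "(\<lambda>j. LINT x|lborel. q j x) \<longlonglongrightarrow> (LINT x|lborel. partial_deriv i F x)"
  proof (rule integral_dominated_convergence[where w = "\<lambda>x. M * indicator (cball 0 (R + 1)) x"])
    show "partial_deriv i F \<in> borel_measurable lborel"
      using cont by (simp add: borel_measurable_continuous_onI)
    show "q j \<in> borel_measurable lborel" for j unfolding q_def by measurable
    show "integrable lborel (\<lambda>x. M * indicator (cball 0 (R + 1)) x :: real)"
      by (intro integrable_mult_right integrable_real_indicator) (auto simp: emeasure_bounded_finite[OF bounded_cball, simplified])
    show "AE x in lborel. (\<lambda>j. q j x) \<longlonglongrightarrow> partial_deriv i F x"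
    proof (rule AE_I2)
      fix x
      have "((\<lambda>t. (F (x + t *\<^sub>R axis i 1) - F x) / t) \<longlongrightarrow> partial_deriv i F x) (at 0)"
        using has_real_derivative_along_axis[OF diff, of x i 0] by (simp add: has_field_derivative_iff)
      moreover have "filterlim h (at 0) sequentially"
      proof -
        have "h \<longlonglongrightarrow> 0" unfolding h_def[abs_def] by (rule LIMSEQ_inverse_real_of_nat)
        moreover have "h k \<noteq> 0" for k using h(1)[of k] by simp
        ultimately show ?thesis by (simp add: filterlim_at)
      qed
      ultimately show "(\<lambda>j. q j x) \<longlonglongrightarrow> partial_deriv i F x"
        unfolding q_def by (rule filterlim_compose)
    qed
    show "AE x in lborel. norm (q j x) \<le> M * indicator (cball 0 (R + 1)) x" for j
    proof (rule AE_I2)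
      fix x :: "real ^ 'n"
      show "norm (q j x) \<le> M * indicator (cball 0 (R + 1)) x"
      proof (cases "norm x \<le> R + 1")
        case False
        have "norm x \<le> norm (x + h j *\<^sub>R axis i 1) + norm (h j *\<^sub>R axis i (1::real) :: real ^ 'n)"
          using norm_triangle_ineq4[of "x + h j *\<^sub>R axis i 1" "h j *\<^sub>R axis i 1"] by simp
        then have "R < norm (x + h j *\<^sub>R axis i 1)" using False h[of j] by simp
        then show ?thesis using False supp by (simp add: q_def)
      next
        case True
        have "\<exists>z>0. z < h j \<and> F (x + h j *\<^sub>R axis i 1) - F (x + 0 *\<^sub>R axis i 1)
             = (h j - 0) * partial_deriv i F (x + z *\<^sub>R axis i 1)"
          by (rule MVT2) (use h has_real_derivative_along_axis[OF diff] in auto)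
        then obtain z where "F (x + h j *\<^sub>R axis i 1) - F (x + 0 *\<^sub>R axis i 1)
             = (h j - 0) * partial_deriv i F (x + z *\<^sub>R axis i 1)" by blast
        then have "q j x = partial_deriv i F (x + z *\<^sub>R axis i 1)"
          using h[of j] by (simp add: q_def)
        then show ?thesis using bd True by simp
      qed
    qed
  qed
  then show ?thesis unfolding q0 by (simp add: LIMSEQ_const_iff)
qed

lemma partial_deriv_mult:
  assumes "f differentiable (at x)" "g differentiable (at x)"
  shows "partial_deriv i (\<lambda>x. f x * g x) x = f x * partial_deriv i g x + partial_deriv i f x * g x"
proof -
  have "((\<lambda>x. f x * g x) has_derivative
     (\<lambda>h. f x * frechet_derivative g (at x) h + frechet_derivative f (at x) h * g x)) (at x)"
    using assms by (intro has_derivative_mult) (auto simp: frechet_derivative_works)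
  from partial_deriv_eqI[OF this] show ?thesis by (simp add: partial_deriv_def)
qed

lemma test_function_mult_integrable:
  fixes f g :: "real ^ 'n \<Rightarrow> real"
  assumes f: "test_function f" and g: "test_function g"
  shows "integrable lborel (\<lambda>x. f x * g x)"
proof -
  obtain M where M: "\<And>x. \<bar>f x\<bar> \<le> M" by (rule test_function_bounded[OF f], rule that)
  have [measurable]: "f \<in> borel_measurable borel" "g \<in> borel_measurable borel"
    using f g by (auto intro: test_function_measurable)
  show ?thesis
  proof (rule Bochner_Integration.integrable_bound)
    show "integrable lborel (\<lambda>x. M * g x)" using test_function_integrable[OF g] by simp
    show "AE x in lborel. norm (f x * g x) \<le> norm (M * g x)"
      using order_trans[OF M abs_ge_self] by (auto simp: abs_mult intro!: mult_right_mono)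
  qed auto
qed

lemma integral_by_parts_test_function:
  fixes f g :: "real ^ 'n \<Rightarrow> real"
  assumes f: "test_function f" and g: "test_function g"
  shows "(LINT x|lborel. f x * partial_deriv i g x) = - (LINT x|lborel. partial_deriv i f x * g x)"
proof -
  note f' = test_function_partial_deriv[OF f, of i] and g' = test_function_partial_deriv[OF g, of i]
  note df = test_function_differentiable[OF f] and dg = test_function_differentiable[OF g]
  have D: "partial_deriv i (\<lambda>x. f x * g x) = (\<lambda>x. f x * partial_deriv i g x + partial_deriv i f x * g x)"
    using partial_deriv_mult[OF df dg] by auto
  obtain R where R: "\<And>x. R < norm x \<Longrightarrow> f x = 0" by (rule test_function_support[OF f], rule that)
  obtain Mf where Mf: "\<And>x. \<bar>f x\<bar> \<le> Mf" by (rule test_function_bounded[OF f], rule that)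
  obtain Mg where Mg: "\<And>x. \<bar>g x\<bar> \<le> Mg" by (rule test_function_bounded[OF g], rule that)
  obtain Mf' where Mf': "\<And>x. \<bar>partial_deriv i f x\<bar> \<le> Mf'" by (rule test_function_bounded[OF f'], rule that)
  obtain Mg' where Mg': "\<And>x. \<bar>partial_deriv i g x\<bar> \<le> Mg'" by (rule test_function_bounded[OF g'], rule that)
  have "(LINT x|lborel. partial_deriv i (\<lambda>x. f x * g x) x) = 0"
  proof (rule integral_partial_deriv_eq_0)
    show "(\<lambda>x. f x * g x) differentiable (at x)" for x
      by (rule differentiable_mult[OF df dg])
    show "continuous_on UNIV (partial_deriv i (\<lambda>x. f x * g x))"
      unfolding D
      by (intro continuous_on_add continuous_on_mult) (simp_all add: test_function_continuous f g f' g')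
    show "f x * g x = 0" if "R < norm x" for x using R that by simp
    show "integrable lborel (\<lambda>x. f x * g x)" by (rule test_function_mult_integrable[OF f g])
    show "\<bar>partial_deriv i (\<lambda>x. f x * g x) x\<bar> \<le> Mf * Mg' + Mf' * Mg" for x
    proof -
      have nn: "0 \<le> Mf" "0 \<le> Mf'" using abs_ge_zero Mf Mf' order_trans by blast+
      have "\<bar>f x * partial_deriv i g x\<bar> \<le> Mf * Mg'"
        unfolding abs_mult by (intro mult_mono Mf Mg' nn abs_ge_zero)
      moreover have "\<bar>partial_deriv i f x * g x\<bar> \<le> Mf' * Mg"
        unfolding abs_mult by (intro mult_mono Mf' Mg nn abs_ge_zero)
      ultimately show ?thesis unfolding D by linarith
    qed
  qed
  moreover have "(LINT x|lborel. partial_deriv i (\<lambda>x. f x * g x) x)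
      = (LINT x|lborel. f x * partial_deriv i g x) + (LINT x|lborel. partial_deriv i f x * g x)"
    unfolding D by (rule Bochner_Integration.integral_add[OF
      test_function_mult_integrable[OF f g'] test_function_mult_integrable[OF f' g]])
  ultimately show ?thesis by linarith
qed

text \<open>
  The order of differentiation is reversed when the derivatives move to the other factor.  Keeping
  track of it makes the symmetry of mixed partial derivatives unnecessary.
\<close>

lemma integral_by_parts_foldr:
  fixes u \<phi> :: "real ^ 'n \<Rightarrow> real"
  assumes u: "test_function u" and \<phi>: "test_function \<phi>"
  shows "(LINT x|lborel. u x * foldr partial_deriv is \<phi> x)
       = (-1) ^ length is * (LINT x|lborel. foldr partial_deriv (rev is) u x * \<phi> x)"
  using u
proof (induction "is" arbitrary: u)
  case (Cons i "is")
  have "(LINT x|lborel. u x * foldr partial_deriv (i # is) \<phi> x)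
      = - (LINT x|lborel. partial_deriv i u x * foldr partial_deriv is \<phi> x)"
    using integral_by_parts_test_function[OF Cons.prems test_function_foldr[OF \<phi>], of i "is"] by simp
  also have "\<dots> = - ((-1) ^ length is * (LINT x|lborel. foldr partial_deriv (rev is) (partial_deriv i u) x * \<phi> x))"
    using Cons.IH[OF test_function_partial_deriv[OF Cons.prems]] by simp
  finally show ?case by simp
qed simp

lemma foldr_partial_deriv_sum_dilates:
  fixes \<phi> :: "real ^ 'n \<Rightarrow> real" and K :: nat
  assumes \<phi>: "test_function \<phi>"
  shows "foldr partial_deriv is (\<lambda>x. \<Sum>k<K. h k * \<phi> (r k *\<^sub>R x)) =
    (\<lambda>x. \<Sum>k<K. h k * r k ^ length is * foldr partial_deriv is \<phi> (r k *\<^sub>R x))"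
proof (induction "is")
  case (Cons i "is")
  let ?\<psi> = "foldr partial_deriv is \<phi>"
  note d\<psi> = test_function_differentiable[OF test_function_foldr[OF \<phi>, of "is"]]
  have "partial_deriv i (\<lambda>x. \<Sum>k<K. h k * r k ^ length is * ?\<psi> (r k *\<^sub>R x)) x
     = (\<Sum>k<K. h k * r k ^ length (i # is) * partial_deriv i ?\<psi> (r k *\<^sub>R x))" for x
  proof -
    have "((\<lambda>x. ?\<psi> (r k *\<^sub>R x)) has_derivative (\<lambda>v. frechet_derivative ?\<psi> (at (r k *\<^sub>R x)) (r k *\<^sub>R v))) (at x)" for k
    proof -
      have "((\<lambda>x. r k *\<^sub>R x) has_derivative (\<lambda>v. r k *\<^sub>R v)) (at x)" by (auto intro!: derivative_eq_intros)
      moreover have "(?\<psi> has_derivative frechet_derivative ?\<psi> (at (r k *\<^sub>R x))) (at (r k *\<^sub>R x))"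
        using d\<psi> by (simp add: frechet_derivative_works)
      ultimately show ?thesis using diff_chain_at[of "\<lambda>x. r k *\<^sub>R x"] by (simp add: o_def)
    qed
    then have D1: "((\<lambda>x. \<Sum>k<K. h k * r k ^ length is * ?\<psi> (r k *\<^sub>R x)) has_derivative
       (\<lambda>v. \<Sum>k<K. h k * r k ^ length is * frechet_derivative ?\<psi> (at (r k *\<^sub>R x)) (r k *\<^sub>R v))) (at x)"
      by (intro has_derivative_sum has_derivative_mult_right)
    have D2: "frechet_derivative ?\<psi> (at y) (c *\<^sub>R v) = c * frechet_derivative ?\<psi> (at y) v" for y c v
      using linear_frechet_derivative[OF d\<psi>[of y]] by (simp add: linear_cmul)
    show ?thesis
      unfolding partial_deriv_eqI[OF D1] D2 by (simp add: partial_deriv_def mult_ac)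
  qed
  then show ?case unfolding foldr.simps comp_apply Cons.IH by (rule ext)
qed simp

lemma test_function_sum_dilates:
  fixes \<phi> :: "real ^ 'n \<Rightarrow> real" and K :: nat
  assumes \<phi>: "test_function \<phi>" and r: "\<And>k. 0 < r k"
  shows "test_function (\<lambda>x. \<Sum>k<K. h k * \<phi> (r k *\<^sub>R x))"
proof -
  obtain R where R: "0 < R" "\<And>x. R < norm x \<Longrightarrow> \<phi> x = 0" by (rule test_function_support[OF \<phi>], rule that)
  show ?thesis
  proof (rule test_functionI)
    fix "is" x
    let ?\<psi> = "foldr partial_deriv is \<phi>"
    have "(\<lambda>x. ?\<psi> (r k *\<^sub>R x)) differentiable (at x)" for k
    proof -
      have "(?\<psi> \<circ> (\<lambda>x. r k *\<^sub>R x)) differentiable (at x)"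
        by (intro differentiable_chain_at test_function_differentiable test_function_foldr \<phi>) auto
      then show ?thesis by (simp add: o_def)
    qed
    then show "foldr partial_deriv is (\<lambda>x. \<Sum>k<K. h k * \<phi> (r k *\<^sub>R x)) differentiable (at x)"
      unfolding foldr_partial_deriv_sum_dilates[OF \<phi>]
      by (intro differentiable_sum ballI differentiable_mult) auto
  next
    fix x :: "real ^ 'n" assume x: "(\<Sum>k<K. R / r k) < norm x"
    have "h k * \<phi> (r k *\<^sub>R x) = 0" if "k < K" for k
    proof -
      have "R / r k \<le> (\<Sum>k<K. R / r k)"
        by (rule member_le_sum) (use that R r in \<open>auto intro: divide_nonneg_pos less_imp_le\<close>)
      then have "R / r k < norm x" using x by simp
      then have "R < norm (r k *\<^sub>R x)" using r[of k] by (simp add: field_simps)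
      then show ?thesis using R by simp
    qed
    then show "(\<Sum>k<K. h k * \<phi> (r k *\<^sub>R x)) = 0" by (intro sum.neutral) auto
  qed
qed

lemma test_function_oscillation:
  assumes \<psi>: "test_function \<psi>"
  shows "\<exists>L>0. \<exists>R>0. \<forall>x y. \<bar>\<psi> x - \<psi> y\<bar>
    \<le> L * min (norm (x - y)) 1 * (if norm x \<le> R \<or> norm y \<le> R then 1 else 0)"
proof -
  obtain R where R: "0 < R" "\<And>x. R < norm x \<Longrightarrow> \<psi> x = 0" by (rule test_function_support[OF \<psi>], rule that)
  obtain M where M: "0 < M" "\<And>x. \<bar>\<psi> x\<bar> \<le> M" by (rule test_function_bounded[OF \<psi>], rule that)
  obtain L where L: "0 < L" "\<And>x y. \<bar>\<psi> x - \<psi> y\<bar> \<le> L * norm (x - y)"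
    by (rule test_function_lipschitz[OF \<psi>], rule that)
  have "\<bar>\<psi> x - \<psi> y\<bar> \<le> (L + 2 * M) * min (norm (x - y)) 1 * (if norm x \<le> R \<or> norm y \<le> R then 1 else 0)" for x y
  proof (cases "norm x \<le> R \<or> norm y \<le> R")
    case False
    then show ?thesis using R by simp
  next
    case True
    have "\<bar>\<psi> x - \<psi> y\<bar> \<le> (L + 2 * M) * norm (x - y)"
    proof -
      have "0 \<le> 2 * M * norm (x - y)" using M(1) by simp
      then show ?thesis unfolding distrib_right using L(2)[of x y] by linarith
    qed
    moreover have "\<bar>\<psi> x - \<psi> y\<bar> \<le> L + 2 * M" using M(2)[of x] M(2)[of y] L(1) by linarith
    ultimately show ?thesis using True by (simp add: min_def)
  qed
  then show ?thesis using L(1) M(1) R(1) by (intro exI[of _ "L + 2 * M"] conjI exI[of _ R]) auto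
qed

lemma test_functions_uniform_oscillation:
  assumes "finite S" "\<And>i. i \<in> S \<Longrightarrow> test_function (\<psi> i)"
  shows "\<exists>L>0. \<exists>R>0. \<forall>i\<in>S. \<forall>x y. \<bar>\<psi> i x - \<psi> i y\<bar>
    \<le> L * min (norm (x - y)) 1 * (if norm x \<le> R \<or> norm y \<le> R then 1 else 0)"
proof -
  have "\<forall>i\<in>S. \<exists>L R. 0 < L \<and> 0 < R \<and> (\<forall>x y. \<bar>\<psi> i x - \<psi> i y\<bar>
    \<le> L * min (norm (x - y)) 1 * (if norm x \<le> R \<or> norm y \<le> R then 1 else 0))"
    using assms(2) test_function_oscillation by blast
  then obtain L R where LR: "\<And>i. i \<in> S \<Longrightarrow> 0 < L i \<and> 0 < R i \<and> (\<forall>x y. \<bar>\<psi> i x - \<psi> i y\<bar>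
    \<le> L i * min (norm (x - y)) 1 * (if norm x \<le> R i \<or> norm y \<le> R i then 1 else 0))"
    by metis
  define L' where "L' = 1 + sum L S"
  define R' where "R' = 1 + sum R S"
  have "0 \<le> sum L S" "0 \<le> sum R S" by (intro sum_nonneg; use LR less_imp_le in blast)+
  then have pos: "0 < L'" "0 < R'" by (auto simp: L'_def R'_def)
  have "\<bar>\<psi> i x - \<psi> i y\<bar> \<le> L' * min (norm (x - y)) 1 * (if norm x \<le> R' \<or> norm y \<le> R' then 1 else 0)"
    if i: "i \<in> S" for i x y
  proof -
    have "L i \<le> sum L S" "R i \<le> sum R S"
      by (rule member_le_sum[OF i _ assms(1)]; use LR less_imp_le in blast)+
    then have "L i \<le> L'" "R i \<le> R'" by (simp_all add: L'_def R'_def)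
    then have "L i * min (norm (x - y)) 1 * (if norm x \<le> R i \<or> norm y \<le> R i then 1 else 0)
        \<le> L' * min (norm (x - y)) 1 * (if norm x \<le> R' \<or> norm y \<le> R' then 1 else 0)"
      using pos by (intro mult_mono) auto
    then show ?thesis using LR[OF i] order_trans by blast
  qed
  then show ?thesis using pos by blast
qed

section \<open>Smooth bump functions\<close>

text \<open>
  The functions \<open>p(1/t) exp(-1/t)\<close> for \<open>t > 0\<close>, extended by \<open>0\<close> to \<open>t \<le> 0\<close>, with a polynomial \<open>p\<close>.
  This family is closed under differentiation, so each of its members is smooth.
\<close>

definition flat_fun :: "real poly \<Rightarrow> real \<Rightarrow> real" where
  "flat_fun p t = (if 0 < t then poly p (1 / t) * exp (- (1 / t)) else 0)"

lemma poly_times_exp_minus_tendsto_0: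
  "((\<lambda>y. poly p y * exp (- y)) \<longlongrightarrow> (0::real)) at_top"
proof (induction p)
  case (pCons a p)
  have lim: "((\<lambda>y. y ^ k * exp (- y)) \<longlongrightarrow> (0::real)) at_top" for k
    using tendsto_power_div_exp_0[of k] by (simp add: exp_minus divide_inverse)
  have "((\<lambda>y. \<Sum>i\<le>degree (pCons a p). coeff (pCons a p) i * (y ^ i * exp (- y))) \<longlongrightarrow> (\<Sum>i\<le>degree (pCons a p). coeff (pCons a p) i * 0)) at_top"
    by (intro tendsto_intros lim)
  then show ?case unfolding poly_altdef by (simp add: sum_distrib_right mult.assoc)
qed simp

lemma flat_fun_has_derivative:
  "(flat_fun p has_real_derivative flat_fun ([:0, 0, 1:] * (p - pderiv p)) t) (at t)"
proof -
  consider "t < 0" | "t = 0" | "0 < t" by linarith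
  then show ?thesis
  proof cases
    case 1
    have "((\<lambda>_. 0) has_real_derivative 0) (at t)" by simp
    then have "(flat_fun p has_real_derivative 0) (at t)"
      by (rule has_field_derivative_transform_within_open[where S = "{..<0}"])
        (use 1 in \<open>auto simp: flat_fun_def\<close>)
    then show ?thesis using 1 by (simp add: flat_fun_def)
  next
    case 2
    have R: "((\<lambda>h. poly (pCons 0 p) (inverse h) * exp (- inverse h)) \<longlongrightarrow> 0) (at_right 0)"
      by (rule filterlim_compose[OF poly_times_exp_minus_tendsto_0 filterlim_inverse_at_top_right])
    have "((\<lambda>h. flat_fun p h / h) \<longlongrightarrow> 0) (at_right 0)"
      by (rule Lim_transform_eventually[OF R])
        (auto simp: eventually_at_right_field flat_fun_def field_simps intro!: exI[of _ 1])
    moreover have "((\<lambda>h. flat_fun p h / h) \<longlongrightarrow> 0) (at_left 0)"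
      by (rule Lim_transform_eventually[OF tendsto_const])
        (auto simp: eventually_at_left_field flat_fun_def intro!: exI[of _ "-1"])
    ultimately have "((\<lambda>h. flat_fun p h / h) \<longlongrightarrow> 0) (at 0)"
      by (rule filterlim_split_at[rotated])
    then show ?thesis using 2 by (simp add: has_field_derivative_iff flat_fun_def)
  next
    case 3
    have "((\<lambda>t. poly p (1 / t) * exp (- (1 / t))) has_real_derivative
        flat_fun ([:0, 0, 1:] * (p - pderiv p)) t) (at t)"
      using 3 by (auto intro!: derivative_eq_intros simp: flat_fun_def field_simps power2_eq_square)
    then show ?thesis
      by (rule has_field_derivative_transform_within_open[where S = "{0<..}"])
        (use 3 in \<open>auto simp: flat_fun_def\<close>)
  qed
qed

text \<open>
  The algebra generated by the constants and the functions \<open>flat_fun p\<close> of an affine function of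
  one coordinate.  It is closed under partial derivatives and consists of differentiable functions,
  hence of smooth ones.
\<close>

inductive flat_alg :: "(real ^ 'n \<Rightarrow> real) \<Rightarrow> bool" where
  const: "flat_alg (\<lambda>x. c)"
| flat: "flat_alg (\<lambda>x. flat_fun p (a * x $ i + b))"
| add: "flat_alg f \<Longrightarrow> flat_alg g \<Longrightarrow> flat_alg (\<lambda>x. f x + g x)"
| mult: "flat_alg f \<Longrightarrow> flat_alg g \<Longrightarrow> flat_alg (\<lambda>x. f x * g x)"

lemma flat_alg_prod:
  assumes "finite S" "\<And>i. i \<in> S \<Longrightarrow> flat_alg (f i)"
  shows "flat_alg (\<lambda>x. \<Prod>i\<in>S. f i x)"
  using assms by (induction S) (auto intro: flat_alg.intros)

lemma flat_affine_has_derivative: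
  "((\<lambda>x. flat_fun p (a * x $ i + b)) has_derivative
     (\<lambda>h. flat_fun ([:0, 0, 1:] * (p - pderiv p)) (a * x $ i + b) * (a * h $ i))) (at x)"
proof -
  have 1: "((\<lambda>x. a * x $ i + b) has_derivative (\<lambda>h. a * h $ i)) (at x)"
    by (auto intro!: derivative_eq_intros bounded_linear_imp_has_derivative bounded_linear_vec_nth)
  have "(flat_fun p has_derivative (*) (flat_fun ([:0, 0, 1:] * (p - pderiv p)) (a * x $ i + b)))
      (at (a * x $ i + b))"
    using flat_fun_has_derivative by (simp add: has_field_derivative_def)
  from diff_chain_at[OF 1 this] show ?thesis by (simp only: o_def)
qed

lemma flat_alg_differentiable: "flat_alg f \<Longrightarrow> f differentiable (at x)"
proof (induction rule: flat_alg.induct)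
  case (flat p a i b)
  then show ?case using flat_affine_has_derivative differentiableI by blast
qed auto

lemma flat_alg_partial_deriv: "flat_alg f \<Longrightarrow> flat_alg (partial_deriv j f)"
proof (induction rule: flat_alg.induct)
  case (const c)
  have "partial_deriv j (\<lambda>x::real^'a. c) = (\<lambda>x. 0)"
    by (rule ext) (simp add: partial_deriv_eqI[OF has_derivative_const])
  then show ?case by (simp add: flat_alg.const)
next
  case (flat p a i b)
  have "partial_deriv j (\<lambda>x::real^'a. flat_fun p (a * x $ i + b)) =
      (\<lambda>x. flat_fun ([:0, 0, 1:] * (p - pderiv p)) (a * x $ i + b) * (a * axis j 1 $ i))"
    by (rule ext, rule partial_deriv_eqI[OF flat_affine_has_derivative])
  then show ?case using flat_alg.mult[OF flat_alg.flat flat_alg.const] by metis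
next
  case (add f g)
  have "partial_deriv j (\<lambda>x. f x + g x) = (\<lambda>x. partial_deriv j f x + partial_deriv j g x)"
  proof
    fix x
    have "((\<lambda>x. f x + g x) has_derivative
        (\<lambda>h. frechet_derivative f (at x) h + frechet_derivative g (at x) h)) (at x)"
      using add.hyps[THEN flat_alg_differentiable]
      by (intro has_derivative_add) (auto simp: frechet_derivative_works)
    from partial_deriv_eqI[OF this]
    show "partial_deriv j (\<lambda>x. f x + g x) x = partial_deriv j f x + partial_deriv j g x"
      by (simp add: partial_deriv_def)
  qed
  then show ?case using add by (auto intro: flat_alg.intros)
next
  case (mult f g)
  have "partial_deriv j (\<lambda>x. f x * g x) = (\<lambda>x. f x * partial_deriv j g x + partial_deriv j f x * g x)"
    using mult.hyps[THEN flat_alg_differentiable] by (intro ext partial_deriv_mult)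
  then show ?case using mult by (auto intro: flat_alg.intros)
qed

lemma flat_alg_foldr: "flat_alg f \<Longrightarrow> flat_alg (foldr partial_deriv is f)"
  by (induction "is") (auto intro: flat_alg_partial_deriv)

text \<open>
  A smooth function that is positive exactly on the open box with corners \<open>a\<close> and \<open>b\<close>, provided
  that \<open>c > 0\<close>.  It tends to the indicator function of this box as \<open>c \<rightarrow> \<infinity>\<close>.
\<close>

definition box_bump :: "real \<Rightarrow> real ^ 'n \<Rightarrow> real ^ 'n \<Rightarrow> real ^ 'n \<Rightarrow> real" where
  "box_bump c a b x = (\<Prod>i\<in>UNIV. flat_fun 1 (c * (x $ i - a $ i)) * flat_fun 1 (c * (b $ i - x $ i)))"

lemma flat_fun_1_bounds: "0 \<le> flat_fun 1 t" "flat_fun 1 t \<le> 1"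
  by (auto simp: flat_fun_def)

lemma box_bump_bounds: "0 \<le> box_bump c a b x" "box_bump c a b x \<le> 1"
  unfolding box_bump_def
  by (auto intro!: prod_nonneg prod_le_1 mult_nonneg_nonneg mult_le_one flat_fun_1_bounds)

lemma box_bump_outside:
  assumes "0 < c" "x \<notin> box a b"
  shows "box_bump c a b x = 0"
proof -
  obtain i where "\<not> (a $ i < x $ i \<and> x $ i < b $ i)"
    using assms(2) by (auto simp: mem_box_cart)
  then have "flat_fun 1 (c * (x $ i - a $ i)) * flat_fun 1 (c * (b $ i - x $ i)) = 0"
    using assms(1) by (auto simp: flat_fun_def zero_less_mult_iff)
  then show ?thesis unfolding box_bump_def by (intro prod_zero) auto
qed

lemma box_bump_inside: "0 < c \<Longrightarrow> x \<in> box a b \<Longrightarrow> 0 < box_bump c a b x"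
  unfolding box_bump_def by (intro prod_pos) (auto simp: mem_box_cart flat_fun_def)

lemma test_function_box_bump:
  fixes a b :: "real ^ 'n"
  assumes c: "0 < c"
  shows "test_function (box_bump c a b)"
proof -
  have "flat_alg (\<lambda>x. flat_fun 1 (c * (x $ i - a $ i)) * flat_fun 1 (c * (b $ i - x $ i)))" for i
    using flat_alg.mult[OF flat_alg.flat[of 1 c i "- c * a $ i"] flat_alg.flat[of 1 "- c" i "c * b $ i"]]
    by (simp add: algebra_simps)
  then have alg: "flat_alg (box_bump c a b)"
    unfolding box_bump_def[abs_def] by (intro flat_alg_prod) auto
  have "bounded (box a b)" by (rule bounded_box)
  then obtain R where "\<And>x. x \<in> box a b \<Longrightarrow> norm x \<le> R" unfolding bounded_iff by blast
  then show ?thesis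
    by (intro test_functionI[of _ R] flat_alg_differentiable flat_alg_foldr alg)
      (metis box_bump_outside c not_less)
qed

lemma box_bump_tendsto_indicator:
  "(\<lambda>j. box_bump (real (Suc j)) a b x) \<longlonglongrightarrow> indicator (box a b) x"
proof (cases "x \<in> box a b")
  case False
  then show ?thesis by (simp add: box_bump_outside del: of_nat_Suc)
next
  case True
  have lim: "(\<lambda>j. flat_fun 1 (real (Suc j) * d)) \<longlonglongrightarrow> 1" if d: "0 < d" for d
  proof -
    have "(\<lambda>j. exp (- (inverse (real (Suc j)) / d))) \<longlonglongrightarrow> exp (- (0 / d))"
      using d by (intro tendsto_intros LIMSEQ_inverse_real_of_nat) auto
    moreover have "flat_fun 1 (real (Suc j) * d) = exp (- (inverse (real (Suc j)) / d))" for j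
      using d by (simp add: flat_fun_def divide_inverse zero_less_mult_iff)
    ultimately show ?thesis by simp
  qed
  have "(\<lambda>j. box_bump (real (Suc j)) a b x) \<longlonglongrightarrow> (\<Prod>i\<in>(UNIV::'a set). 1 * 1)"
    unfolding box_bump_def using True by (intro tendsto_intros lim) (auto simp: mem_box_cart)
  then show ?thesis using True by simp
qed

section \<open>Weak derivatives of test functions\<close>

text \<open>
  The boxes are stable under intersection and generate the Borel sets, so the integral of \<open>f\<close> over
  every bounded Borel set vanishes.
\<close>

lemma AE_eq_0_if_box_integrals_eq_0:
  fixes f :: "'a::euclidean_space \<Rightarrow> real"
  assumes f: "\<And>K. compact K \<Longrightarrow> set_integrable lborel K f" and [measurable]: "f \<in> borel_measurable borel"
    and z: "\<And>a b. (LINT x:box a b|lborel. f x) = 0"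
  shows "AE x in lborel. f x = 0"
proof -
  have "AE x in lborel. x \<in> box (- (real N *\<^sub>R One)) (real N *\<^sub>R One) \<longrightarrow> f x = 0" for N
  proof -
    let ?B = "box (- (real N *\<^sub>R One)) (real N *\<^sub>R One) :: 'a set"
    define g where "g x = indicator ?B x * f x" for x
    have "set_integrable lborel ?B f"
      by (rule set_integrable_subset[OF f[OF compact_cbox]]) (simp, rule box_subset_cbox)
    then have g: "integrable lborel g" by (simp add: set_integrable_def g_def[abs_def])
    have zg: "(LINT x:A|lborel. g x) = 0" if "A \<in> sets borel" for A
    proof -
      have "Int_stable (range (\<lambda>(a, b). box a b :: 'a set))"
        by (auto simp: Int_stable_def box_Int_box)
      moreover have "range (\<lambda>(a, b). box a b :: 'a set) \<subseteq> Pow UNIV" by auto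
      moreover have "A \<in> sigma_sets UNIV (range (\<lambda>(a, b). box a b))"
        using that unfolding borel_eq_box by simp
      ultimately show ?thesis
      proof (induction rule: sigma_sets_induct_disjoint)
        case (basic A)
        then obtain a b where A: "A = box a b" by auto
        obtain a' b' where ab: "A \<inter> ?B = box a' b'" unfolding A box_Int_box by blast
        have "(LINT x:A|lborel. g x) = (LINT x:A \<inter> ?B|lborel. f x)"
          unfolding set_lebesgue_integral_def g_def
          by (intro Bochner_Integration.integral_cong) (auto simp: indicator_def)
        then show ?case using z by (simp add: ab)
      next
        case empty
        then show ?case by (simp add: set_lebesgue_integral_def)
      next
        case (compl A)
        then have [measurable]: "A \<in> sets borel" by (simp add: borel_eq_box)
        have "(LINT x:UNIV - A|lborel. g x) = (LINT x|lborel. g x - indicator A x * g x)"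
          unfolding set_lebesgue_integral_def
          by (intro Bochner_Integration.integral_cong) (auto simp: indicator_def)
        also have "\<dots> = (LINT x|lborel. g x) - (LINT x:A|lborel. g x)"
          using integrable_mult_indicator[OF _ g, of A] g
          by (simp add: set_lebesgue_integral_def)
        also have "(LINT x|lborel. g x) = (LINT x:?B|lborel. f x)"
          by (simp add: set_lebesgue_integral_def g_def)
        finally show ?case using compl z by simp
      next
        case (union F)
        then have [measurable]: "\<And>i. F i \<in> sets borel"
          by (simp add: borel_eq_box subset_eq)
        have "(LINT x:(\<Union>i. F i)|lborel. g x) = (\<Sum>i. LINT x:F i|lborel. g x)"
        proof (rule lebesgue_integral_countable_add)
          show "F i \<inter> F j = {}" if "i \<noteq> j" for i j
            using union that by (auto simp: disjoint_family_on_def)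
          show "set_integrable lborel (\<Union>i. F i) g"
            unfolding set_integrable_def by (intro integrable_mult_indicator g) simp
        qed auto
        then show ?case using union by simp
      qed
    qed
    have "AE x in lborel. g x = 0"
      by (rule density_unique_real[OF g]) (use zg in \<open>auto simp: set_lebesgue_integral_def\<close>)
    then show ?thesis by eventually_elim (auto simp: g_def)
  qed
  then have "AE x in lborel. \<forall>N. x \<in> box (- (real N *\<^sub>R One)) (real N *\<^sub>R One) \<longrightarrow> f x = 0"
    unfolding AE_all_countable by blast
  then show ?thesis
  proof eventually_elim
    case (elim x)
    have "x \<in> (\<Union>N. box (- (real N *\<^sub>R One)) (real N *\<^sub>R One))" unfolding UN_box_eq_UNIV by simp
    then show ?case using elim by blast
  qed
qed

lemma locally_integrable_mult_test_function:
  assumes w: "locally_integrable w" and \<phi>: "test_function \<phi>"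
  shows "integrable lebesgue (\<lambda>x. w x * \<phi> x)"
proof -
  obtain R where R: "0 < R" "\<And>x. R < norm x \<Longrightarrow> \<phi> x = 0" by (rule test_function_support[OF \<phi>], rule that)
  obtain M where M: "0 < M" "\<And>x. \<bar>\<phi> x\<bar> \<le> M" by (rule test_function_bounded[OF \<phi>], rule that)
  have w': "integrable lebesgue (\<lambda>x. indicator (cball 0 R) x * w x)"
    using w by (simp add: locally_integrable_def set_integrable_def)
  have [measurable]: "\<phi> \<in> borel_measurable lebesgue"
    using test_function_measurable[OF \<phi>] by (simp add: measurable_completion)
  have "integrable lebesgue (\<lambda>x. (indicator (cball 0 R) x * w x) * \<phi> x)"
  proof (rule Bochner_Integration.integrable_bound)
    show "integrable lebesgue (\<lambda>x. M * (indicator (cball 0 R) x * w x))" using w' by simp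
    show "(\<lambda>x. (indicator (cball 0 R) x * w x) * \<phi> x) \<in> borel_measurable lebesgue"
      using borel_measurable_integrable[OF w'] by simp
    show "AE x in lebesgue. norm ((indicator (cball 0 R) x * w x) * \<phi> x) \<le> norm (M * (indicator (cball 0 R) x * w x))"
      using M by (intro AE_I2) (auto simp: abs_mult indicator_def mult.commute intro!: mult_right_mono)
  qed
  also have "(\<lambda>x. (indicator (cball 0 R) x * w x) * \<phi> x) = (\<lambda>x. w x * \<phi> x)"
    using R by (auto simp: indicator_def fun_eq_iff not_le)
  finally show ?thesis .
qed

text \<open>
  Uniqueness of weak derivatives.  The bump functions approximate the indicator function of a box,
  so the integral of \<open>w - w'\<close> over each box vanishes.
\<close>

lemma AE_eq_if_test_integrals_eq:
  fixes w w' :: "real ^ 'n \<Rightarrow> real"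
  assumes w: "locally_integrable w" and w': "locally_integrable w'"
    and eq: "\<And>\<phi>. test_function \<phi> \<Longrightarrow> (LINT x|lebesgue. w x * \<phi> x) = (LINT x|lebesgue. w' x * \<phi> x)"
  shows "AE x in lebesgue. w x = w' x"
proof -
  define d where "d x = w x - w' x" for x
  have d: "set_integrable lebesgue K d" if "compact K" for K
    using w w' that unfolding d_def[abs_def] locally_integrable_def by (intro set_integral_diff) auto
  have dl: "locally_integrable d" using d by (simp add: locally_integrable_def)
  have zd: "(LINT x|lebesgue. d x * \<phi> x) = 0" if "test_function \<phi>" for \<phi>
    using eq[OF that] locally_integrable_mult_test_function[OF w that] locally_integrable_mult_test_function[OF w' that]
    by (simp add: d_def left_diff_distrib)
  have "d \<in> borel_measurable lebesgue"
  proof (rule borel_measurable_LIMSEQ_real)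
    show "(\<lambda>x. indicator (cball 0 (real N)) x * d x) \<in> borel_measurable lebesgue" for N
      using borel_measurable_integrable[OF d[OF compact_cball, unfolded set_integrable_def]] by simp
    fix x :: "real ^ 'n"
    obtain N0 where N0: "norm x \<le> real N0" using real_arch_simple by blast
    show "(\<lambda>N. indicator (cball 0 (real N)) x * d x) \<longlonglongrightarrow> d x"
      by (rule tendsto_eventually, rule eventually_sequentiallyI[of N0]) (use N0 in \<open>auto simp: indicator_def\<close>)
  qed
  from completion_ex_borel_measurable_real[OF this]
  obtain f where [measurable]: "f \<in> borel_measurable borel" and df: "AE x in lborel. d x = f x" by auto
  have df': "AE x in lebesgue. d x = f x" using df by (rule AE_completion)
  have f: "set_integrable lborel K f" if K: "compact K" for K
  proof -
    have [measurable]: "K \<in> sets borel" using K by (simp add: compact_imp_closed)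
    have "integrable lebesgue (\<lambda>x. indicator K x *\<^sub>R d x)"
      using d[OF K] by (simp add: set_integrable_def)
    then have "integrable lebesgue (\<lambda>x. indicator K x *\<^sub>R f x)"
    proof (rule integrable_cong_AE_imp)
      show "(\<lambda>x. indicator K x *\<^sub>R f x) \<in> borel_measurable lebesgue"
        by (intro measurable_completion) simp
      show "AE x in lebesgue. indicator K x *\<^sub>R d x = indicator K x *\<^sub>R f x"
        using df' by eventually_elim simp
    qed
    then show ?thesis by (simp add: set_integrable_def integrable_completion)
  qed
  have zf: "(LINT x|lborel. f x * \<phi> x) = 0" if \<phi>: "test_function \<phi>" for \<phi>
  proof -
    note [measurable] = test_function_measurable[OF \<phi>]
    have m: "(\<lambda>x. f x * \<phi> x) \<in> borel_measurable lborel" by simp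
    have "(LINT x|lborel. f x * \<phi> x) = (LINT x|lebesgue. f x * \<phi> x)"
      using m by (simp add: integral_completion)
    also have "\<dots> = (LINT x|lebesgue. d x * \<phi> x)"
    proof (rule integral_cong_AE)
      show "(\<lambda>x. f x * \<phi> x) \<in> borel_measurable lebesgue" using m by (rule measurable_completion)
      show "(\<lambda>x. d x * \<phi> x) \<in> borel_measurable lebesgue"
        using locally_integrable_mult_test_function[OF dl \<phi>] by simp
      show "AE x in lebesgue. f x * \<phi> x = d x * \<phi> x" using df' by eventually_elim simp
    qed
    finally show ?thesis using zd[OF \<phi>] by simp
  qed
  have "AE x in lborel. f x = 0"
  proof (rule AE_eq_0_if_box_integrals_eq_0[OF f])
    fix a b :: "real ^ 'n"
    have "(\<lambda>j. LINT x|lborel. f x * box_bump (real (Suc j)) a b x) \<longlonglongrightarrow> (LINT x|lborel. f x * indicator (box a b) x)"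
    proof (rule integral_dominated_convergence[where w = "\<lambda>x. \<bar>indicator (cbox a b) x * f x\<bar>"])
      show "integrable lborel (\<lambda>x. \<bar>indicator (cbox a b) x * f x\<bar>)"
        using f[of "cbox a b"] by (simp add: set_integrable_def)
      show "(\<lambda>x. f x * box_bump (real (Suc j)) a b x) \<in> borel_measurable lborel" for j
        using test_function_measurable[OF test_function_box_bump[of "real (Suc j)" a b]] by simp
      show "AE x in lborel. (\<lambda>j. f x * box_bump (real (Suc j)) a b x) \<longlonglongrightarrow> f x * indicator (box a b) x"
        by (intro AE_I2 tendsto_intros box_bump_tendsto_indicator)
      show "AE x in lborel. norm (f x * box_bump (real (Suc j)) a b x) \<le> \<bar>indicator (cbox a b) x * f x\<bar>" for j
      proof (rule AE_I2)
        fix x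
        show "norm (f x * box_bump (real (Suc j)) a b x) \<le> \<bar>indicator (cbox a b) x * f x\<bar>"
        proof (cases "x \<in> box a b")
          case True
          then have "x \<in> cbox a b" using box_subset_cbox by blast
          then show ?thesis using box_bump_bounds[of "real (Suc j)" a b x]
            by (simp add: abs_mult mult_left_le)
        next
          case False
          then show ?thesis by (simp add: box_bump_outside del: of_nat_Suc)
        qed
      qed
    qed auto
    then show "(LINT x:box a b|lborel. f x) = 0"
      by (simp add: zf test_function_box_bump set_lebesgue_integral_def mult.commute LIMSEQ_const_iff del: of_nat_Suc)
  qed measurable
  then have "AE x in lebesgue. f x = 0" by (rule AE_completion)
  then show ?thesis using df' by eventually_elim (simp add: d_def)
qed

text \<open>
  The classical derivative of multi-index \<open>\<alpha>\<close>, with the order of differentiation opposite to that of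
  \<open>multi_deriv\<close>; this is the order that integration by parts produces.
\<close>

definition ordered_deriv :: "'n multiset \<Rightarrow> (real ^ 'n \<Rightarrow> real) \<Rightarrow> real ^ 'n \<Rightarrow> real" where
  "ordered_deriv \<alpha> u = foldr partial_deriv (rev (SOME is. mset is = \<alpha>)) u"

lemma length_chosen_list: "length (SOME is. mset is = \<alpha>) = size \<alpha>"
proof -
  have "mset (SOME is. mset is = \<alpha>) = \<alpha>" by (rule someI_ex) (rule ex_mset)
  then show ?thesis by (metis size_mset)
qed

lemma test_function_ordered_deriv: "test_function u \<Longrightarrow> test_function (ordered_deriv \<alpha> u)"
  unfolding ordered_deriv_def by (rule test_function_foldr)

lemma test_function_locally_integrable:
  assumes u: "test_function u"
  shows "locally_integrable u"
proof -
  have "u absolutely_integrable_on K" if "compact K" for K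
  proof -
    have [measurable]: "K \<in> sets borel" using that by (simp add: compact_imp_closed)
    have "set_integrable lborel K u"
      unfolding set_integrable_def using test_function_integrable[OF u] by (intro integrable_mult_indicator) auto
    then show ?thesis
      using test_function_measurable[OF u] by (simp add: set_integrable_def integrable_completion)
  qed
  then show ?thesis by (simp add: locally_integrable_def)
qed

lemma has_weak_deriv_test_function:
  fixes u :: "real ^ 'n \<Rightarrow> real"
  assumes u: "test_function u"
  shows "has_weak_deriv u \<alpha> (ordered_deriv \<alpha> u)"
  unfolding has_weak_deriv_def
proof (intro conjI allI impI)
  show "locally_integrable u" "locally_integrable (ordered_deriv \<alpha> u)"
    by (intro test_function_locally_integrable test_function_ordered_deriv u)+
  fix \<phi> :: "real ^ 'n \<Rightarrow> real" assume \<phi>: "test_function \<phi>"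
  have m: "u \<in> borel_measurable borel" "\<phi> \<in> borel_measurable borel"
    "multi_deriv \<alpha> \<phi> \<in> borel_measurable borel" "ordered_deriv \<alpha> u \<in> borel_measurable borel"
    using u \<phi> unfolding multi_deriv_def
    by (auto intro!: test_function_measurable test_function_foldr test_function_ordered_deriv)
  note [measurable] = m
  show "(LINT x|lebesgue. u x * multi_deriv \<alpha> \<phi> x) = (-1) ^ size \<alpha> * (LINT x|lebesgue. ordered_deriv \<alpha> u x * \<phi> x)"
    using integral_by_parts_foldr[OF u \<phi>, of "SOME is. mset is = \<alpha>"]
    by (simp add: integral_completion) (simp add: multi_deriv_def ordered_deriv_def length_chosen_list)
qed

lemma weak_deriv_test_function:
  fixes u :: "real ^ 'n \<Rightarrow> real"
  assumes u: "test_function u"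
  shows "AE x in lebesgue. weak_deriv u \<alpha> x = ordered_deriv \<alpha> u x"
proof (cases "\<alpha> = {#}")
  case True
  then show ?thesis by (simp add: weak_deriv_def ordered_deriv_def)
next
  case False
  have D: "has_weak_deriv u \<alpha> (ordered_deriv \<alpha> u)" by (rule has_weak_deriv_test_function[OF u])
  then have w: "has_weak_deriv u \<alpha> (weak_deriv u \<alpha>)"
    using False someI[of "has_weak_deriv u \<alpha>"] by (simp add: weak_deriv_def)
  show ?thesis
  proof (rule AE_eq_if_test_integrals_eq)
    show "locally_integrable (weak_deriv u \<alpha>)" "locally_integrable (ordered_deriv \<alpha> u)"
      using w D by (auto simp: has_weak_deriv_def)
    fix \<phi> :: "real ^ 'n \<Rightarrow> real" assume \<phi>: "test_function \<phi>"
    have "(-1) ^ size \<alpha> * (LINT x|lebesgue. weak_deriv u \<alpha> x * \<phi> x)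
        = (-1) ^ size \<alpha> * (LINT x|lebesgue. ordered_deriv \<alpha> u x * \<phi> x)"
      using w D \<phi> unfolding has_weak_deriv_def by metis
    then show "(LINT x|lebesgue. weak_deriv u \<alpha> x * \<phi> x) = (LINT x|lebesgue. ordered_deriv \<alpha> u x * \<phi> x)"
      by simp
  qed
qed

section \<open>Modulars of superpositions of dilates\<close>

text \<open>
  For \<open>\<rho> > 0\<close> this is \<open>min \<rho> 1 / \<rho>\<^sup>\<sigma>\<close>: up to a constant, the largest difference quotient of order
  \<open>\<sigma>\<close> at distance \<open>\<rho>\<close> of a bounded Lipschitz function.
\<close>

definition osc_weight :: "real \<Rightarrow> real \<Rightarrow> real" where
  "osc_weight \<sigma> \<rho> = min (\<rho> powr (1 - \<sigma>)) (\<rho> powr (- \<sigma>))"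

lemma osc_weight_nonneg: "0 \<le> osc_weight \<sigma> \<rho>"
  by (simp add: osc_weight_def)

lemma osc_weight_eq: "0 < \<rho> \<Longrightarrow> osc_weight \<sigma> \<rho> = min \<rho> 1 / \<rho> powr \<sigma>"
  by (simp add: osc_weight_def powr_diff powr_minus divide_inverse min_def)

text \<open>
  The sum is dominated by two geometric series, one over the scales above \<open>r\<close> and one over the
  scales below \<open>r\<close>.  For the induction on \<open>K\<close> the bound is strengthened to one that depends on \<open>r\<close>,
  because separating the term \<open>k = 0\<close> replaces \<open>r\<close> by \<open>r / 2\<close>.
\<close>

lemma sum_osc_weight_bounded:
  assumes \<sigma>: "0 < \<sigma>" "\<sigma> < 1"
  obtains W where "0 < W" "\<And>K r. 0 < r \<Longrightarrow> (\<Sum>k<K. osc_weight \<sigma> (r / 2 ^ k)) \<le> W"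
proof -
  define q where "q = (1/2::real) powr (1 - \<sigma>)"
  define p where "p = (2::real) powr \<sigma>"
  define C1 where "C1 = 1 / (1 - q)"
  define C2 where "C2 = 1 / (p - 1)"
  have q: "0 < q" "q < 1" using \<sigma> by (auto simp: q_def powr01_less_one)
  have p: "1 < p" using \<sigma> by (simp add: p_def)
  have C1: "0 < C1" "1 + C1 * q = C1" using q by (auto simp: C1_def field_simps)
  have C2: "0 < C2" "1 + C2 = C2 * p" using p by (auto simp: C2_def field_simps)
  have half: "(r / 2) powr (1 - \<sigma>) = r powr (1 - \<sigma>) * q" "(r / 2) powr (- \<sigma>) = r powr (- \<sigma>) * p"
    if "0 < r" for r
    using that by (auto simp: q_def p_def powr_divide powr_minus field_simps)
  have main: "(\<Sum>k<K. osc_weight \<sigma> (r / 2 ^ k))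
      \<le> (if r \<le> 1 then C1 * r powr (1 - \<sigma>) else C1 + 1 + C2 - C2 * r powr (- \<sigma>))"
    if "0 < r" for r :: real and K :: nat
    using that
  proof (induction K arbitrary: r)
    case 0
    have "r powr (- \<sigma>) \<le> 1" if "1 < r" using that \<sigma> powr_mono2'[of "- \<sigma>" 1 r] by simp
    then have "C2 * r powr (- \<sigma>) \<le> C2" if "\<not> r \<le> 1" using C2 that by (simp add: mult_left_le)
    then have "C2 * r powr (- \<sigma>) \<le> C1 + 1 + C2" if "\<not> r \<le> 1" using C1 that by fastforce
    then show ?case using C1 by simp
  next
    case (Suc K)
    have "(\<Sum>k<Suc K. osc_weight \<sigma> (r / 2 ^ k)) = osc_weight \<sigma> r + (\<Sum>k<K. osc_weight \<sigma> (r / 2 / 2 ^ k))"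
      by (subst sum.lessThan_Suc_shift) (simp add: mult.commute)
    also have "\<dots> \<le> osc_weight \<sigma> r + (if r / 2 \<le> 1 then C1 * (r / 2) powr (1 - \<sigma>) else C1 + 1 + C2 - C2 * (r / 2) powr (- \<sigma>))"
      using Suc.IH[of "r / 2"] Suc.prems by simp
    also have "\<dots> \<le> (if r \<le> 1 then C1 * r powr (1 - \<sigma>) else C1 + 1 + C2 - C2 * r powr (- \<sigma>))"
    proof -
      consider "r \<le> 1" | "1 < r" "r \<le> 2" | "2 < r" by linarith
      then show ?thesis
      proof cases
        case 1
        have "osc_weight \<sigma> r + C1 * (r / 2) powr (1 - \<sigma>) \<le> r powr (1 - \<sigma>) * (1 + C1 * q)"
          unfolding half[OF Suc.prems] by (simp add: osc_weight_def algebra_simps)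
        then show ?thesis using 1 C1 by (simp add: mult.commute)
      next
        case 2
        have "osc_weight \<sigma> r \<le> r powr (- \<sigma>)" by (simp add: osc_weight_def)
        moreover have le1: "r powr (- \<sigma>) \<le> 1" using 2 \<sigma> powr_mono2'[of "- \<sigma>" 1 r] by simp
        moreover have "(r / 2) powr (1 - \<sigma>) \<le> 1" using 2 \<sigma> by (intro powr_le1) auto
        then have "C1 * (r / 2) powr (1 - \<sigma>) \<le> C1" using C1 by (simp add: mult_left_le)
        moreover have "C2 * r powr (- \<sigma>) \<le> C2" using le1 C2 by (simp add: mult_left_le)
        ultimately show ?thesis using 2 by simp
      next
        case 3
        have "osc_weight \<sigma> r + (C1 + 1 + C2 - C2 * (r / 2) powr (- \<sigma>))
            \<le> r powr (- \<sigma>) + (C1 + 1 + C2 - r powr (- \<sigma>) * (1 + C2))"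
          unfolding half[OF Suc.prems] C2(2) by (simp add: osc_weight_def)
        also have "\<dots> = C1 + 1 + C2 - C2 * r powr (- \<sigma>)" by (simp add: algebra_simps)
        finally show ?thesis using 3 by simp
      qed
    qed
    finally show ?case .
  qed
  show ?thesis
  proof (rule that[of "C1 + 1 + C2"])
    fix K :: nat and r :: real assume r: "0 < r"
    have le: "C1 * r powr (1 - \<sigma>) \<le> C1" if "r \<le> 1"
      using r C1 \<sigma> that by (intro mult_left_le powr_le1) auto
    have nn: "0 \<le> C2 * r powr (- \<sigma>)" using C2 by simp
    show "(\<Sum>k<K. osc_weight \<sigma> (r / 2 ^ k)) \<le> C1 + 1 + C2"
    proof (cases "r \<le> 1")
      case True
      then show ?thesis using main[OF r, of K] le C2(1) by simp
    next
      case False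
      then have "(\<Sum>k<K. osc_weight \<sigma> (r / 2 ^ k)) \<le> C1 + 1 + C2 - C2 * r powr (- \<sigma>)"
        using main[OF r, of K] by simp
      then show ?thesis using nn by linarith
    qed
  qed (use C1 C2 in auto)
qed

text \<open>
  The weight at scale \<open>2\<^sup>k\<close>, multiplied by the density \<open>|z|\<^sup>-\<^sup>n\<close> of the measure in the modular.
\<close>

definition osc_kernel :: "real \<Rightarrow> nat \<Rightarrow> real ^ 'n \<Rightarrow> ennreal" where
  "osc_kernel \<sigma> k z = ennreal (osc_weight \<sigma> (norm z / 2 ^ k) / norm z ^ CARD('n))"

lemma osc_kernel_measurable [measurable]: "osc_kernel \<sigma> k \<in> borel_measurable borel"
  unfolding osc_kernel_def osc_weight_def by measurable

lemma dyadic_below_1: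
  fixes \<rho> :: real
  assumes "0 < \<rho>" "\<rho> \<le> 1"
  obtains j where "(1/2) ^ Suc j < \<rho>" "\<rho> \<le> (1/2) ^ j"
proof -
  obtain m where m: "(1/2) ^ m < \<rho>" using real_arch_pow_inv[of \<rho> "1/2"] assms by auto
  define l where "l = (LEAST m. (1/2) ^ m < \<rho>)"
  have l: "(1/2) ^ l < \<rho>" unfolding l_def using m by (rule LeastI)
  then obtain j where j: "l = Suc j" using assms by (cases l) auto
  have "\<not> (1/2) ^ j < \<rho>" using not_less_Least[of j "\<lambda>m. (1/2) ^ m < \<rho>"] j l_def by simp
  then show ?thesis using that[of j] l j by simp
qed

lemma dyadic_above_1:
  fixes \<rho> :: real
  assumes "1 < \<rho>"
  obtains j where "2 ^ j \<le> \<rho>" "\<rho> < 2 ^ Suc j"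
proof -
  obtain m where m: "\<rho> < 2 ^ m" using real_arch_pow[of 2 \<rho>] by auto
  define l where "l = (LEAST m. \<rho> < 2 ^ m)"
  have l: "\<rho> < 2 ^ l" unfolding l_def using m by (rule LeastI)
  then obtain j where j: "l = Suc j" using assms by (cases l) auto
  have "\<not> \<rho> < 2 ^ j" using not_less_Least[of j "\<lambda>m. \<rho> < 2 ^ m"] j l_def by simp
  then show ?thesis using that[of j] l j by simp
qed

text \<open>
  The bound \<open>M\<close> does not depend on the scale \<open>k\<close>.  On each dyadic annulus around \<open>y\<close> the kernel is
  estimated by a constant (\<open>T1\<close> inside the ball of radius \<open>2\<^sup>k\<close>, \<open>T2\<close> outside), and the integrals over
  the annuli form two geometric series.
\<close>

lemma osc_kernel_integral_bounded:
  assumes \<sigma>: "0 < \<sigma>" "\<sigma> < 1"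
  obtains M where "0 \<le> M" "\<And>k (y::real^'n). (\<integral>\<^sup>+x. osc_kernel \<sigma> k (x - y) \<partial>lborel) \<le> ennreal M"
proof -
  let ?n = "CARD('n)"
  define q where "q = (1/2::real) powr (1 - \<sigma>)"
  define p where "p = (1/2::real) powr \<sigma>"
  define V where "V = unit_ball_vol (real ?n)"
  have q: "0 < q" "q < 1" using \<sigma> by (auto simp: q_def powr01_less_one)
  have p: "0 < p" "p < 1" using \<sigma> by (auto simp: p_def powr01_less_one)
  have V: "0 \<le> V" by (simp add: V_def)
  have qj: "((1/2) ^ j) powr (1 - \<sigma>) = q ^ j" for j
    by (simp add: q_def powr_power powr_realpow[symmetric] powr_powr mult.commute)
  have pj: "((1/2) ^ j) powr \<sigma> = p ^ j" for j
    by (simp add: p_def powr_power powr_realpow[symmetric] powr_powr mult.commute)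
  define M where "M = 2 ^ ?n * V * (1 / (1 - q)) + 2 ^ ?n * V * (1 / (1 - p))"
  have "(\<integral>\<^sup>+x. osc_kernel \<sigma> k (x - y) \<partial>lborel) \<le> ennreal M" for k and y :: "real ^ 'n"
  proof -
    define T1 where "T1 j x = ennreal (2 ^ ?n * q ^ j * (2 ^ j / 2 ^ k) ^ ?n) * indicator (cball y (2 ^ k / 2 ^ j)) x"
      for j and x :: "real ^ 'n"
    define T2 where "T2 j x = ennreal (p ^ j * (1 / 2 ^ (k + j)) ^ ?n) * indicator (cball y (2 ^ (k + j + 1))) x"
      for j and x :: "real ^ 'n"
    have [measurable]: "T1 j \<in> borel_measurable borel" "T2 j \<in> borel_measurable borel" for j
      unfolding T1_def T2_def
      by (intro borel_measurable_times_ennreal borel_measurable_const borel_measurable_indicator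
          borel_closed closed_cball)+
    have dom: "osc_kernel \<sigma> k (x - y) \<le> (\<Sum>j. T1 j x) + (\<Sum>j. T2 j x)" for x
    proof (cases "x = y")
      case True
      then show ?thesis by (simp add: osc_kernel_def osc_weight_def)
    next
      case False
      define \<rho> where "\<rho> = norm (x - y) / 2 ^ k"
      have \<rho>: "0 < \<rho>" "norm (x - y) = \<rho> * 2 ^ k" using False by (auto simp: \<rho>_def)
      have kernel: "osc_kernel \<sigma> k (x - y) = ennreal (osc_weight \<sigma> \<rho> * (1 / norm (x - y)) ^ ?n)"
        by (simp only: osc_kernel_def \<rho>_def power_one_over times_divide_eq_right mult_1_right)
      show ?thesis
      proof (cases "\<rho> \<le> 1")
        case True
        obtain j where j: "(1/2) ^ Suc j < \<rho>" "\<rho> \<le> (1/2) ^ j" using dyadic_below_1 \<rho> True by blast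
        have "osc_weight \<sigma> \<rho> \<le> \<rho> powr (1 - \<sigma>)" by (simp add: osc_weight_def)
        also have "\<dots> \<le> q ^ j" unfolding qj[symmetric] using j \<rho> \<sigma> by (intro powr_mono2) auto
        finally have w: "osc_weight \<sigma> \<rho> \<le> q ^ j" .
        have "1 / norm (x - y) \<le> 2 * (2 ^ j / 2 ^ k)"
          using j \<rho> by (simp add: field_simps)
        then have "(1 / norm (x - y)) ^ ?n \<le> (2 * (2 ^ j / 2 ^ k)) ^ ?n"
          by (intro power_mono) auto
        then have "osc_weight \<sigma> \<rho> * (1 / norm (x - y)) ^ ?n \<le> q ^ j * (2 * (2 ^ j / 2 ^ k)) ^ ?n"
          using w q by (intro mult_mono) auto
        also have "\<dots> = 2 ^ ?n * q ^ j * (2 ^ j / 2 ^ k) ^ ?n"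
          by (simp only: power_mult_distrib mult_ac)
        finally have "osc_kernel \<sigma> k (x - y) \<le> ennreal (2 ^ ?n * q ^ j * (2 ^ j / 2 ^ k) ^ ?n)"
          unfolding kernel by (rule ennreal_leI)
        moreover have "x \<in> cball y (2 ^ k / 2 ^ j)"
          using j \<rho> by (simp add: dist_norm norm_minus_commute power_one_over field_simps)
        ultimately have "osc_kernel \<sigma> k (x - y) \<le> T1 j x" by (simp add: T1_def)
        also have "\<dots> \<le> (\<Sum>j. T1 j x)" by (rule ennreal_le_suminf_term)
        finally show ?thesis by (simp add: add_increasing2)
      next
        case False
        then obtain j where j: "2 ^ j \<le> \<rho>" "\<rho> < 2 ^ Suc j" using dyadic_above_1[of \<rho>] by auto
        have "osc_weight \<sigma> \<rho> \<le> \<rho> powr (- \<sigma>)" by (simp add: osc_weight_def)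
        also have "\<dots> \<le> (2 ^ j) powr (- \<sigma>)" using j \<rho> \<sigma> by (intro powr_mono2') auto
        also have "\<dots> = p ^ j" unfolding pj[symmetric] by (simp add: powr_minus_divide power_one_over powr_divide)
        finally have w: "osc_weight \<sigma> \<rho> \<le> p ^ j" .
        have "1 / norm (x - y) \<le> 1 / 2 ^ (k + j)"
          using j \<rho> by (simp add: field_simps power_add)
        then have "(1 / norm (x - y)) ^ ?n \<le> (1 / 2 ^ (k + j)) ^ ?n"
          by (intro power_mono) auto
        then have "osc_weight \<sigma> \<rho> * (1 / norm (x - y)) ^ ?n \<le> p ^ j * (1 / 2 ^ (k + j)) ^ ?n"
          using w p by (intro mult_mono) auto
        then have "osc_kernel \<sigma> k (x - y) \<le> ennreal (p ^ j * (1 / 2 ^ (k + j)) ^ ?n)"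
          unfolding kernel by (rule ennreal_leI)
        moreover have "x \<in> cball y (2 ^ (k + j + 1))"
          using j \<rho> by (simp add: dist_norm norm_minus_commute power_add field_simps)
        ultimately have "osc_kernel \<sigma> k (x - y) \<le> T2 j x" by (simp add: T2_def)
        also have "\<dots> \<le> (\<Sum>j. T2 j x)" by (rule ennreal_le_suminf_term)
        finally show ?thesis by (simp add: add_increasing)
      qed
    qed
    have I1: "(\<integral>\<^sup>+x. T1 j x \<partial>lborel) = ennreal (2 ^ ?n * V * q ^ j)" for j
    proof -
      have "(\<integral>\<^sup>+x. T1 j x \<partial>lborel) = ennreal (2 ^ ?n * q ^ j * (2 ^ j / 2 ^ k) ^ ?n) * ennreal (V * (2 ^ k / 2 ^ j) ^ ?n)"
        unfolding T1_def by (subst nn_integral_cmult_indicator) (auto simp: emeasure_cball V_def)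
      also have "\<dots> = ennreal ((2 ^ ?n * q ^ j * (2 ^ j / 2 ^ k) ^ ?n) * (V * (2 ^ k / 2 ^ j) ^ ?n))"
        by (rule ennreal_mult[symmetric]) (use q V in auto)
      also have "(2 ^ ?n * q ^ j * (2 ^ j / 2 ^ k) ^ ?n) * (V * (2 ^ k / 2 ^ j) ^ ?n)
          = (2 ^ ?n * V * q ^ j) * ((2 ^ j / 2 ^ k) * (2 ^ k / 2 ^ j)) ^ ?n"
        by (simp only: power_mult_distrib mult_ac)
      also have "(2 ^ j / 2 ^ k) * (2 ^ k / 2 ^ j) = (1::real)" by simp
      finally show ?thesis by simp
    qed
    have I2: "(\<integral>\<^sup>+x. T2 j x \<partial>lborel) = ennreal (2 ^ ?n * V * p ^ j)" for j
    proof -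
      have "(\<integral>\<^sup>+x. T2 j x \<partial>lborel) = ennreal (p ^ j * (1 / 2 ^ (k + j)) ^ ?n) * ennreal (V * (2 ^ (k + j + 1)) ^ ?n)"
        unfolding T2_def by (subst nn_integral_cmult_indicator) (auto simp: emeasure_cball V_def)
      also have "\<dots> = ennreal ((p ^ j * (1 / 2 ^ (k + j)) ^ ?n) * (V * (2 ^ (k + j + 1)) ^ ?n))"
        by (rule ennreal_mult[symmetric]) (use p V in auto)
      also have "(p ^ j * (1 / 2 ^ (k + j)) ^ ?n) * (V * (2 ^ (k + j + 1)) ^ ?n)
          = ((1 / 2 ^ (k + j)) * 2 ^ (k + j + 1)) ^ ?n * V * p ^ j"
        by (simp only: power_mult_distrib mult_ac)
      also have "(1 / 2 ^ (k + j)) * 2 ^ (k + j + 1) = (2::real)" by simp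
      finally show ?thesis by simp
    qed
    have geo: "(\<Sum>j. ennreal (2 ^ ?n * V * c ^ j)) = ennreal (2 ^ ?n * V * (1 / (1 - c)))"
      if "0 < c" "c < 1" for c
      by (intro suminf_ennreal_eq sums_mult geometric_sums) (use V that in auto)
    have "(\<integral>\<^sup>+x. osc_kernel \<sigma> k (x - y) \<partial>lborel) \<le> (\<integral>\<^sup>+x. (\<Sum>j. T1 j x) + (\<Sum>j. T2 j x) \<partial>lborel)"
      by (intro nn_integral_mono dom)
    also have "\<dots> = (\<Sum>j. \<integral>\<^sup>+x. T1 j x \<partial>lborel) + (\<Sum>j. \<integral>\<^sup>+x. T2 j x \<partial>lborel)"
      by (simp add: nn_integral_add nn_integral_suminf)
    also have "\<dots> = ennreal M"
      unfolding I1 I2 geo[OF q] geo[OF p] M_def using V p q by (subst ennreal_plus) auto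
    finally show ?thesis .
  qed
  moreover have "0 \<le> M" unfolding M_def using V p q by simp
  ultimately show ?thesis using that by blast
qed

lemma osc_kernel_double_integral:
  fixes B :: "(real ^ 'n) set"
  assumes M: "\<And>k (y::real^'n). (\<integral>\<^sup>+x. osc_kernel \<sigma> k (x - y) \<partial>lborel) \<le> ennreal M"
    and [measurable]: "B \<in> sets borel"
  shows "(\<integral>\<^sup>+y. (\<integral>\<^sup>+x. osc_kernel \<sigma> k (x - y) * (indicator B x + indicator B y) \<partial>lborel) \<partial>lborel)
      \<le> 2 * (ennreal M * emeasure lborel B)"
proof -
  have M': "(\<integral>\<^sup>+y. osc_kernel \<sigma> k (x - y) \<partial>lborel) \<le> ennreal M" for x :: "real ^ 'n"
    using M[of k x] by (simp add: osc_kernel_def norm_minus_commute)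
  have ind: "(\<integral>\<^sup>+y. ennreal M * indicator B y \<partial>lborel) = ennreal M * emeasure lborel B"
    by (simp add: nn_integral_cmult_indicator)
  have "(\<integral>\<^sup>+y. (\<integral>\<^sup>+x. osc_kernel \<sigma> k (x - y) * (indicator B x + indicator B y) \<partial>lborel) \<partial>lborel)
     = (\<integral>\<^sup>+y. (\<integral>\<^sup>+x. osc_kernel \<sigma> k (x - y) * indicator B x \<partial>lborel) \<partial>lborel)
     + (\<integral>\<^sup>+y. (\<integral>\<^sup>+x. osc_kernel \<sigma> k (x - y) * indicator B y \<partial>lborel) \<partial>lborel)"
    by (simp add: distrib_left nn_integral_add)
  also have "(\<integral>\<^sup>+y. (\<integral>\<^sup>+x. osc_kernel \<sigma> k (x - y) * indicator B x \<partial>lborel) \<partial>lborel)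
     = (\<integral>\<^sup>+x. (\<integral>\<^sup>+y. osc_kernel \<sigma> k (x - y) * indicator B x \<partial>lborel) \<partial>lborel)"
    by (rule lborel_pair.Fubini') measurable
  also have "\<dots> \<le> (\<integral>\<^sup>+x. ennreal M * indicator B x \<partial>lborel)"
    by (intro nn_integral_mono) (simp add: nn_integral_multc mult_right_mono M')
  also have "\<dots> = ennreal M * emeasure lborel B" by (rule ind)
  also have "(\<integral>\<^sup>+y. (\<integral>\<^sup>+x. osc_kernel \<sigma> k (x - y) * indicator B y \<partial>lborel) \<partial>lborel)
      \<le> (\<integral>\<^sup>+y. ennreal M * indicator B y \<partial>lborel)"
    by (intro nn_integral_mono) (simp add: nn_integral_multc mult_right_mono M)
  also have "\<dots> = ennreal M * emeasure lborel B" by (rule ind)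
  finally show ?thesis by (simp add: mult_2 add_mono)
qed

text \<open>
  The key estimate: a vector field \<open>v\<close> whose oscillation is controlled by a sum over the scales \<open>2\<^sup>k\<close>
  has a modular controlled by a sum of values of \<open>A\<close>.  Dividing the weights by the bound \<open>W\<close> on their
  sum makes Jensen's inequality applicable.
\<close>

lemma frac_modular_multiscale_bound:
  fixes A :: "real \<Rightarrow> ennreal"
  assumes A: "young_function A" and \<sigma>: "0 < \<sigma>" "\<sigma> < 1" and R: "0 < R"
  shows "\<exists>C>0. \<exists>W>0. \<forall>(v :: real ^ 'n \<Rightarrow> 'i \<Rightarrow> real) I (K::nat) c.
    (\<forall>k. 0 \<le> c k) \<longrightarrow>
    (\<forall>x y. L2_set (\<lambda>i. v x i - v y i) I \<le> (\<Sum>k<K. c k * min (norm (x - y) / 2 ^ k) 1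
        * (if norm x \<le> R * 2 ^ k \<or> norm y \<le> R * 2 ^ k then 1 else 0))) \<longrightarrow>
    frac_modular \<sigma> A I v \<le> (\<Sum>k<K. ennreal (C * 2 ^ (k * CARD('n))) * A (W * (c k / (2 ^ k) powr \<sigma>)))"
proof -
  let ?n = "CARD('n)"
  obtain W where W: "0 < W" "\<And>K r. 0 < r \<Longrightarrow> (\<Sum>k<K. osc_weight \<sigma> (r / 2 ^ k)) \<le> W"
    using sum_osc_weight_bounded[OF \<sigma>] by blast
  obtain M where M: "0 \<le> M" "\<And>k (y::real^'n). (\<integral>\<^sup>+x. osc_kernel \<sigma> k (x - y) \<partial>lborel) \<le> ennreal M"
    using osc_kernel_integral_bounded[OF \<sigma>] by blast
  define V where "V = unit_ball_vol (real ?n)"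
  have V: "0 < V" by (simp add: V_def)
  define C where "C = 1 / W * (2 * (M * (V * R ^ ?n))) + 1"
  have C0: "0 \<le> 1 / W * (2 * (M * (V * R ^ ?n)))" using W M V R by simp
  have main: "frac_modular \<sigma> A I v \<le> (\<Sum>k<K. ennreal (C * 2 ^ (k * ?n)) * A (W * (c k / (2 ^ k) powr \<sigma>)))"
    if c: "\<And>k. 0 \<le> c k" and
       bound: "\<And>x y. L2_set (\<lambda>i. v x i - v y i) I \<le> (\<Sum>k<K. c k * min (norm (x - y) / 2 ^ k) 1
          * (if norm x \<le> R * 2 ^ k \<or> norm y \<le> R * 2 ^ k then 1 else 0))"
    for v :: "real ^ 'n \<Rightarrow> 'i \<Rightarrow> real" and I K c
  proof -
    define B where "B k = cball (0 :: real ^ 'n) (R * 2 ^ k)" for k :: nat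
    define g where "g k = W * (c k / (2 ^ k) powr \<sigma>)" for k :: nat
    have g: "0 \<le> g k" for k using W c by (simp add: g_def)
    have dom: "A (L2_set (\<lambda>i. v x i - v y i) I / norm (x - y) powr \<sigma>) / ennreal (norm (x - y) ^ ?n)
        \<le> (\<Sum>k<K. (ennreal (1 / W) * A (g k)) * (osc_kernel \<sigma> k (x - y) * (indicator (B k) x + indicator (B k) y)))"
      for x y :: "real ^ 'n"
    proof (cases "x = y")
      case True
      then show ?thesis using young_zero[OF A] by simp
    next
      case False
      define r where "r = norm (x - y)"
      have r: "0 < r" using False by (simp add: r_def)
      define e where "e k = (if norm x \<le> R * 2 ^ k \<or> norm y \<le> R * 2 ^ k then 1 else 0 :: real)" for k :: nat
      define \<theta> where "\<theta> k = osc_weight \<sigma> (r / 2 ^ k) / W * e k" for k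
      have \<theta>: "0 \<le> \<theta> k" for k using W osc_weight_nonneg by (simp add: \<theta>_def e_def)
      have "(\<Sum>k<K. \<theta> k) \<le> (\<Sum>k<K. osc_weight \<sigma> (r / 2 ^ k) / W)"
        using W osc_weight_nonneg by (intro sum_mono) (simp add: \<theta>_def e_def)
      also have "\<dots> \<le> 1" using W(2)[OF r, of K] W(1) by (simp add: sum_divide_distrib[symmetric])
      finally have \<theta>1: "(\<Sum>k<K. \<theta> k) \<le> 1" .
      have summand: "c k * min (r / 2 ^ k) 1 * e k / r powr \<sigma> = \<theta> k * g k" for k
      proof -
        have "r powr \<sigma> = (r / 2 ^ k) powr \<sigma> * (2 ^ k) powr \<sigma>"
          using r by (simp add: powr_divide)
        then show ?thesis using r W by (simp add: \<theta>_def g_def osc_weight_eq)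
      qed
      have "L2_set (\<lambda>i. v x i - v y i) I / r powr \<sigma> \<le> (\<Sum>k<K. c k * min (r / 2 ^ k) 1 * e k) / r powr \<sigma>"
        using bound[of x y] by (intro divide_right_mono) (auto simp: r_def e_def)
      also have "\<dots> = (\<Sum>k<K. \<theta> k * g k)" by (simp add: sum_divide_distrib summand)
      finally have "A (L2_set (\<lambda>i. v x i - v y i) I / r powr \<sigma>) \<le> A (\<Sum>k<K. \<theta> k * g k)"
        by (intro young_mono[OF A]) (auto simp: L2_set_nonneg)
      also have "\<dots> \<le> (\<Sum>k<K. ennreal (\<theta> k) * A (g k))"
        using \<theta> \<theta>1 g by (intro young_jensen[OF A]) auto
      finally have "A (L2_set (\<lambda>i. v x i - v y i) I / r powr \<sigma>) / ennreal (r ^ ?n)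
          \<le> (\<Sum>k<K. ennreal (\<theta> k) * A (g k)) / ennreal (r ^ ?n)"
        by (rule divide_right_mono_ennreal)
      also have "\<dots> = (\<Sum>k<K. (ennreal (\<theta> k) / ennreal (r ^ ?n)) * A (g k))"
        unfolding divide_ennreal_def sum_distrib_right by (simp only: mult_ac)
      also have "\<dots> \<le> (\<Sum>k<K. (ennreal (1 / W) * A (g k)) * (osc_kernel \<sigma> k (x - y) * (indicator (B k) x + indicator (B k) y)))"
      proof (rule sum_mono)
        fix k
        have "ennreal (\<theta> k) / ennreal (r ^ ?n) = ennreal (\<theta> k / r ^ ?n)"
          using \<theta> r by (simp add: divide_ennreal)
        also have "\<theta> k / r ^ ?n = 1 / W * (osc_weight \<sigma> (r / 2 ^ k) / r ^ ?n) * e k"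
          by (simp add: \<theta>_def)
        also have "ennreal \<dots> = ennreal (1 / W) * osc_kernel \<sigma> k (x - y) * ennreal (e k)"
          using W r osc_weight_nonneg by (simp add: osc_kernel_def r_def[symmetric] ennreal_mult[symmetric] e_def)
        also have "\<dots> \<le> ennreal (1 / W) * osc_kernel \<sigma> k (x - y) * (indicator (B k) x + indicator (B k) y)"
          by (intro mult_left_mono) (auto simp: e_def B_def indicator_def)
        finally have le: "ennreal (\<theta> k) / ennreal (r ^ ?n)
            \<le> ennreal (1 / W) * osc_kernel \<sigma> k (x - y) * (indicator (B k) x + indicator (B k) y)" .
        show "(ennreal (\<theta> k) / ennreal (r ^ ?n)) * A (g k)
            \<le> (ennreal (1 / W) * A (g k)) * (osc_kernel \<sigma> k (x - y) * (indicator (B k) x + indicator (B k) y))"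
          using mult_right_mono[OF le, of "A (g k)"] by (simp only: mult_ac zero_le)
      qed
      finally show ?thesis by (simp add: r_def)
    qed
    have meas: "B k \<in> sets borel" for k by (simp add: B_def)
    note [measurable] = meas
    have "frac_modular \<sigma> A I v \<le> (\<integral>\<^sup>+y. (\<integral>\<^sup>+x. (\<Sum>k<K. (ennreal (1 / W) * A (g k)) * (osc_kernel \<sigma> k (x - y) * (indicator (B k) x + indicator (B k) y))) \<partial>lborel) \<partial>lborel)"
      unfolding frac_modular_def nn_integral_completion by (intro nn_integral_mono dom)
    also have "\<dots> = (\<Sum>k<K. (ennreal (1 / W) * A (g k)) * (\<integral>\<^sup>+y. (\<integral>\<^sup>+x. osc_kernel \<sigma> k (x - y) * (indicator (B k) x + indicator (B k) y) \<partial>lborel) \<partial>lborel))"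
      by (simp add: nn_integral_sum nn_integral_cmult)
    also have "\<dots> \<le> (\<Sum>k<K. (ennreal (1 / W) * A (g k)) * (2 * (ennreal M * emeasure lborel (B k))))"
      by (intro sum_mono mult_left_mono osc_kernel_double_integral M meas) auto
    also have "\<dots> \<le> (\<Sum>k<K. ennreal (C * 2 ^ (k * ?n)) * A (g k))"
    proof (rule sum_mono)
      fix k
      have "emeasure lborel (B k) = ennreal (V * R ^ ?n * 2 ^ (k * ?n))"
        unfolding B_def using R
        by (subst emeasure_cball) (auto simp: V_def power_mult_distrib power_mult mult.assoc)
      then have "ennreal (1 / W) * (2 * (ennreal M * emeasure lborel (B k)))
          = ennreal (1 / W * (2 * (M * (V * R ^ ?n * 2 ^ (k * ?n)))))"
        using W(1) by (simp only: ennreal_mult'[OF M(1)] ennreal_mult'[OF zero_le_numeral]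
            ennreal_mult'[of "1 / W"] ennreal_numeral zero_le_divide_1_iff less_imp_le)
      also have "1 / W * (2 * (M * (V * R ^ ?n * 2 ^ (k * ?n)))) \<le> C * 2 ^ (k * ?n)"
        by (simp add: C_def algebra_simps)
      finally have "ennreal (1 / W) * (2 * (ennreal M * emeasure lborel (B k))) \<le> ennreal (C * 2 ^ (k * ?n))"
        by (simp add: ennreal_leI)
      from mult_right_mono[OF this, of "A (g k)"]
      show "(ennreal (1 / W) * A (g k)) * (2 * (ennreal M * emeasure lborel (B k)))
          \<le> ennreal (C * 2 ^ (k * ?n)) * A (g k)"
        by (simp only: mult_ac zero_le)
    qed
    finally show ?thesis by (simp add: g_def)
  qed
  have "0 < C" using C0 by (simp add: C_def)
  then show ?thesis using W(1) main by (intro exI[of _ C] exI[of _ W] conjI allI impI) simp_all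
qed

section \<open>Test functions in the Orlicz--Sobolev space\<close>

lemma finite_multi_indices: "finite (multi_indices k :: 'n::finite multiset set)"
  using finite_multisets_of_size[of "UNIV :: 'n set" k] by (simp add: multi_indices_def multisets_of_size_def)

lemma weak_grad_test_function:
  fixes u :: "real ^ 'n \<Rightarrow> real"
  assumes u: "test_function u"
  shows "AE x in lebesgue. \<forall>\<alpha>\<in>multi_indices k. weak_grad u x \<alpha> = ordered_deriv \<alpha> u x"
  unfolding weak_grad_def by (intro AE_finite_allI finite_multi_indices weak_deriv_test_function u)

lemma frac_modular_cong_AE:
  assumes ae: "AE x in lebesgue. \<forall>i\<in>I. v x i = v' x i"
  shows "frac_modular \<sigma> A I v = frac_modular \<sigma> A I v'"
proof -
  have eq: "L2_set (\<lambda>i. v x i - v y i) I = L2_set (\<lambda>i. v' x i - v' y i) I"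
    if "\<forall>i\<in>I. v x i = v' x i" "\<forall>i\<in>I. v y i = v' y i" for x y
    using that by (intro L2_set_cong) auto
  show ?thesis
    unfolding frac_modular_def
  proof (rule nn_integral_cong_AE)
    show "AE y in lebesgue.
      (\<integral>\<^sup>+ x. A (L2_set (\<lambda>i. v x i - v y i) I / norm (x - y) powr \<sigma>) / ennreal (norm (x - y) ^ CARD('a)) \<partial>lebesgue) =
      (\<integral>\<^sup>+ x. A (L2_set (\<lambda>i. v' x i - v' y i) I / norm (x - y) powr \<sigma>) / ennreal (norm (x - y) ^ CARD('a)) \<partial>lebesgue)"
      using ae
    proof eventually_elim
      case y: (elim y)
      show ?case
      proof (rule nn_integral_cong_AE)
        show "AE x in lebesgue.
          A (L2_set (\<lambda>i. v x i - v y i) I / norm (x - y) powr \<sigma>) / ennreal (norm (x - y) ^ CARD('a)) =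
          A (L2_set (\<lambda>i. v' x i - v' y i) I / norm (x - y) powr \<sigma>) / ennreal (norm (x - y) ^ CARD('a))"
          using ae by eventually_elim (simp only: eq[OF _ y])
      qed
    qed
  qed
qed

lemma V_functional_le_if_modular_le_1:
  fixes u :: "real ^ 'n \<Rightarrow> real"
  assumes u: "test_function u" and r: "0 < r"
    and J: "frac_modular (frac s) A (multi_indices (nat \<lfloor>s\<rfloor>)) (\<lambda>x \<alpha>. ordered_deriv \<alpha> u x / r) \<le> 1"
  shows "V_functional s A u \<le> ennreal r"
proof -
  have "AE x in lebesgue. \<forall>\<alpha>\<in>multi_indices (nat \<lfloor>s\<rfloor>). weak_grad u x \<alpha> / r = ordered_deriv \<alpha> u x / r"
    using weak_grad_test_function[OF u, of "nat \<lfloor>s\<rfloor>"] by eventually_elim simp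
  from frac_modular_cong_AE[OF this]
  have "frac_modular (frac s) A (multi_indices (nat \<lfloor>s\<rfloor>)) (\<lambda>x \<alpha>. weak_grad u x \<alpha> / r) \<le> 1"
    using J by simp
  then show ?thesis
    unfolding V_functional_def frac_seminorm_def using r by (intro Inf_lower imageI) simp
qed

lemma test_function_in_V_space:
  fixes u :: "real ^ 'n \<Rightarrow> real"
  assumes u: "test_function u" and fin: "V_functional s A u < \<infinity>"
  shows "u \<in> V_space s A"
proof -
  have "emeasure lebesgue {x. L2_set (weak_grad u x) (multi_indices k) > t} < \<infinity>" if t: "0 < t" for t k
  proof -
    have "\<exists>R. \<forall>x. R < norm x \<longrightarrow> (\<forall>\<alpha>\<in>multi_indices k. ordered_deriv \<alpha> u x = 0)"
    proof -
      have "\<forall>\<alpha>. \<exists>R>0. \<forall>x. R < norm x \<longrightarrow> ordered_deriv \<alpha> u x = 0"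
        using test_function_support[OF test_function_ordered_deriv[OF u]] by metis
      then obtain \<rho> where \<rho>: "\<And>\<alpha>. 0 < \<rho> \<alpha>" "\<And>\<alpha> x. \<rho> \<alpha> < norm x \<Longrightarrow> ordered_deriv \<alpha> u x = 0" by metis
      have "\<rho> \<alpha> \<le> sum \<rho> (multi_indices k)" if "\<alpha> \<in> multi_indices k" for \<alpha> :: "'n multiset"
        using that \<rho>(1) by (intro member_le_sum finite_multi_indices less_imp_le)
      then show ?thesis using \<rho>(2) by (intro exI[of _ "sum \<rho> (multi_indices k)"]) force
    qed
    then obtain R where R: "\<And>x \<alpha>. R < norm x \<Longrightarrow> \<alpha> \<in> multi_indices k \<Longrightarrow> ordered_deriv \<alpha> u x = 0" by blast
    obtain N where N: "N \<in> null_sets lebesgue"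
      "{x \<in> space lebesgue. \<not> (\<forall>\<alpha>\<in>multi_indices k. weak_grad u x \<alpha> = ordered_deriv \<alpha> u x)} \<subseteq> N"
      using weak_grad_test_function[OF u, of k] unfolding eventually_ae_filter by blast
    have "{x. L2_set (weak_grad u x) (multi_indices k) > t} \<subseteq> N \<union> cball 0 R"
    proof
      fix x assume x: "x \<in> {x. L2_set (weak_grad u x) (multi_indices k) > t}"
      show "x \<in> N \<union> cball 0 R"
      proof (rule ccontr)
        assume "x \<notin> N \<union> cball 0 R"
        then have "x \<notin> N" "R < norm x" by auto
        then have "weak_grad u x \<alpha> = 0" if "\<alpha> \<in> multi_indices k" for \<alpha>
        proof -
          have "weak_grad u x \<alpha> = ordered_deriv \<alpha> u x" using N(2) \<open>x \<notin> N\<close> that by auto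
          then show ?thesis using R[OF \<open>R < norm x\<close> that] by simp
        qed
        then have "L2_set (weak_grad u x) (multi_indices k) = 0"
          by (simp add: L2_set_def)
        then show False using x t by simp
      qed
    qed
    then have "emeasure lebesgue {x. L2_set (weak_grad u x) (multi_indices k) > t} \<le> emeasure lebesgue (N \<union> cball 0 R)"
      using N(1) by (intro emeasure_mono) auto
    also have "\<dots> \<le> emeasure lebesgue N + emeasure lebesgue (cball (0 :: real ^ 'n) R)"
      by (rule emeasure_subadditive) (use N(1) in auto)
    also have "\<dots> < \<infinity>"
      using N(1) emeasure_bounded_finite[OF bounded_cball, of "0 :: real ^ 'n" R] by (simp add: null_sets_def)
    finally show ?thesis .
  qed
  moreover have "weakly_differentiable (nat \<lfloor>s\<rfloor>) u"
    unfolding weakly_differentiable_def using has_weak_deriv_test_function[OF u] by blast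
  moreover have "u \<in> borel_measurable lebesgue"
    using test_function_measurable[OF u] by (intro measurable_completion) simp
  ultimately show ?thesis using fin by (simp add: V_space_def)
qed

section \<open>Necessity of the integral condition\<close>

text \<open>
  The target space enters the argument through this bound: its norm controls the integral over a set
  of finite measure.
\<close>

lemma embedding_imp_integral_le:
  fixes Y :: "(real ^ 'n \<Rightarrow> real) \<Rightarrow> ennreal" and B :: "(real ^ 'n) set"
  assumes Y: "rearrangement_invariant_norm Y" and emb: "continuous_V_embedding s A Y"
    and B: "B \<in> sets lebesgue" "emeasure lebesgue B < \<infinity>"
  shows "\<exists>C>0. \<forall>u\<in>V_space s A.
    (\<integral>\<^sup>+x\<in>B. ennreal \<bar>u x\<bar> \<partial>lebesgue) \<le> ennreal C * V_functional s A u"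
proof -
  have bfn: "banach_function_norm Y" using Y by (simp add: rearrangement_invariant_norm_def)
  have "\<forall>E\<in>sets lebesgue. emeasure lebesgue E < \<infinity> \<longrightarrow> (\<exists>C::real. \<forall>u\<in>borel_measurable lebesgue.
           (\<integral>\<^sup>+ x\<in>E. ennreal \<bar>u x\<bar> \<partial>lebesgue) \<le> ennreal C * Y u)"
    using bfn unfolding banach_function_norm_def by (elim conjE) assumption
  then obtain C1 where C1: "\<And>u. u \<in> borel_measurable lebesgue \<Longrightarrow>
      (\<integral>\<^sup>+ x\<in>B. ennreal \<bar>u x\<bar> \<partial>lebesgue) \<le> ennreal C1 * Y u" using B by blast
  obtain C2 where C2: "\<And>u. u \<in> V_space s A \<Longrightarrow> Y u \<le> ennreal C2 * V_functional s A u"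
    using emb unfolding continuous_V_embedding_def by blast
  define C where "C = max C1 0 * max C2 0 + 1"
  have "(\<integral>\<^sup>+x\<in>B. ennreal \<bar>u x\<bar> \<partial>lebesgue) \<le> ennreal C * V_functional s A u" if u: "u \<in> V_space s A" for u
  proof -
    have "(\<integral>\<^sup>+x\<in>B. ennreal \<bar>u x\<bar> \<partial>lebesgue) \<le> ennreal C1 * Y u"
      using u by (intro C1) (simp add: V_space_def)
    also have "\<dots> \<le> ennreal C1 * (ennreal C2 * V_functional s A u)"
      by (intro mult_left_mono C2 u) auto
    also have "ennreal C1 * (ennreal C2 * V_functional s A u) \<le> ennreal (max C1 0) * (ennreal (max C2 0) * V_functional s A u)"
      by (intro mult_mono ennreal_leI) auto
    also have "\<dots> = ennreal (max C1 0 * max C2 0) * V_functional s A u"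
      by (simp add: ennreal_mult mult.assoc)
    also have "\<dots> \<le> ennreal C * V_functional s A u"
      by (intro mult_right_mono ennreal_leI) (auto simp: C_def)
    finally show ?thesis .
  qed
  moreover have "0 < C" by (simp add: C_def add_nonneg_pos)
  ultimately show ?thesis by blast
qed

text \<open>
  The test function is \<open>\<Sum>\<^sub>k h\<^sub>k \<phi>(x / 2\<^sup>k)\<close>.  Its functional is at most \<open>r = 1 + C\<^sub>m S\<close>, where \<open>S\<close> is the
  sum on the right-hand side of the criterion, because \<open>A(t / r) \<le> A(t) / r\<close>.
\<close>

lemma embedding_imp_discrete_criterion:
  fixes Y :: "(real ^ 'n \<Rightarrow> real) \<Rightarrow> ennreal"
  assumes s: "0 < s" "s \<notin> \<nat>" and A: "young_function A"
    and Y: "rearrangement_invariant_norm Y" and emb: "continuous_V_embedding s A Y"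
  shows "\<exists>C\<ge>0. \<forall>(K::nat) g. (\<forall>k. 0 \<le> g k) \<longrightarrow>
      (\<Sum>k<K. ennreal (2 powr (s * real k) * g k))
        \<le> ennreal C * (1 + (\<Sum>k<K. ennreal (2 ^ (k * CARD('n))) * A (g k)))"
proof -
  let ?n = "CARD('n)"
  define m where "m = nat \<lfloor>s\<rfloor>"
  define \<sigma> where "\<sigma> = frac s"
  have s_eq: "s = real m + \<sigma>" using s by (simp add: m_def \<sigma>_def frac_def)
  have "\<sigma> \<noteq> 0" using s_eq s(2) by auto
  then have \<sigma>: "0 < \<sigma>" "\<sigma> < 1"
    using frac_ge_0[of s] frac_lt_1[of s] unfolding \<sigma>_def by linarith+
  define I where "I = (multi_indices m :: 'n multiset set)"
  have I: "finite I" "\<And>\<alpha>. \<alpha> \<in> I \<Longrightarrow> size \<alpha> = m"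
    by (auto simp: I_def finite_multi_indices) (simp add: multi_indices_def)

  define \<phi> :: "real ^ 'n \<Rightarrow> real" where "\<phi> = box_bump 1 (\<chi> i. -2) (\<chi> i. 2)"
  have \<phi>: "test_function \<phi>" by (simp add: \<phi>_def test_function_box_bump)
  have \<phi>pos: "0 < \<phi> x" if "x \<in> cball 0 1" for x
  proof -
    have "\<bar>x $ i\<bar> < 2" for i using component_le_norm_cart[of x i] that by simp
    then have "x \<in> box (\<chi> i. -2) (\<chi> i. 2)" unfolding mem_box_cart by (simp add: abs_less_iff minus_less_iff)
    then show ?thesis by (simp add: \<phi>_def box_bump_inside)
  qed
  obtain x0 :: "real ^ 'n" where x0: "x0 \<in> cball 0 1" "\<And>x. x \<in> cball 0 1 \<Longrightarrow> \<phi> x0 \<le> \<phi> x"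
    using continuous_attains_inf[OF compact_cball _ test_function_continuous[OF \<phi>], of 0 1] by auto
  define c0 where "c0 = \<phi> x0"
  have c0: "0 < c0" "\<And>x. x \<in> cball 0 1 \<Longrightarrow> c0 \<le> \<phi> x" using x0 \<phi>pos by (auto simp: c0_def)
  define V where "V = unit_ball_vol (real ?n)"
  have V: "0 < V" by (simp add: V_def)
  have emB: "emeasure lborel (cball (0 :: real ^ 'n) 1) = ennreal V" by (simp add: emeasure_cball V_def)

  obtain L R where L: "0 < L" and R: "0 < R" and osc: "\<And>\<alpha> x y. \<alpha> \<in> I \<Longrightarrow>
      \<bar>ordered_deriv \<alpha> \<phi> x - ordered_deriv \<alpha> \<phi> y\<bar>
        \<le> L * min (norm (x - y)) 1 * (if norm x \<le> R \<or> norm y \<le> R then 1 else 0)"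
    using test_functions_uniform_oscillation[OF I(1), of "\<lambda>\<alpha>. ordered_deriv \<alpha> \<phi>"]
      test_function_ordered_deriv[OF \<phi>] by metis
  define L' where "L' = real (card I) * L + 1"
  have L': "0 < L'" "real (card I) * L \<le> L'" using L by (auto simp: L'_def add_nonneg_pos)
  obtain Cm W where Cm: "0 < Cm" and W: "0 < W" and modular:
    "\<forall>(v :: real ^ 'n \<Rightarrow> 'n multiset \<Rightarrow> real) I (K::nat) c. (\<forall>k. 0 \<le> c k) \<longrightarrow>
       (\<forall>x y. L2_set (\<lambda>i. v x i - v y i) I \<le> (\<Sum>k<K. c k * min (norm (x - y) / 2 ^ k) 1
          * (if norm x \<le> R * 2 ^ k \<or> norm y \<le> R * 2 ^ k then 1 else 0))) \<longrightarrow>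
     frac_modular \<sigma> A I v \<le> (\<Sum>k<K. ennreal (Cm * 2 ^ (k * ?n)) * A (W * (c k / (2 ^ k) powr \<sigma>)))"
    using frac_modular_multiscale_bound[OF A \<sigma> R] by blast
  have "emeasure lebesgue (cball (0 :: real ^ 'n) 1) < \<infinity>" by (simp add: emB)
  then obtain Ce where Ce: "0 < Ce" and emb': "\<And>u. u \<in> V_space s A \<Longrightarrow>
      (\<integral>\<^sup>+x\<in>cball (0 :: real ^ 'n) 1. ennreal \<bar>u x\<bar> \<partial>lebesgue) \<le> ennreal Ce * V_functional s A u"
    using embedding_imp_integral_le[OF Y emb, of "cball 0 1"] by auto

  define C where "C = W * L' / (c0 * V) * Ce * (1 + Cm)"
  have Cpos: "0 < C" using W L' c0 V Ce Cm by (simp add: C_def)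
  have "(\<Sum>k<K. ennreal (2 powr (s * real k) * g k))
        \<le> ennreal C * (1 + (\<Sum>k<K. ennreal (2 ^ (k * ?n)) * A (g k)))"
    if g: "\<And>k. 0 \<le> g k" for K :: nat and g
  proof (cases "(\<Sum>k<K. ennreal (2 ^ (k * ?n)) * A (g k)) = \<infinity>")
    case True
    show ?thesis unfolding True using Cpos by (simp add: ennreal_mult_top)
  next
    case False
    then obtain S where S: "(\<Sum>k<K. ennreal (2 ^ (k * ?n)) * A (g k)) = ennreal S" "0 \<le> S"
      by (cases "(\<Sum>k<K. ennreal (2 ^ (k * ?n)) * A (g k))") auto
    \<comment> \<open>The factor \<open>1 / (W L')\<close> cancels the constants with which the modular estimate applies \<open>A\<close>.\<close>
    define h where "h k = 2 powr (s * real k) * g k / (W * L')" for k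
    have h: "0 \<le> h k" for k using g W L' by (simp add: h_def)
    define u where "u = (\<lambda>x. \<Sum>k<K. h k * \<phi> ((1 / 2 ^ k) *\<^sub>R x))"
    have u: "test_function u" unfolding u_def by (rule test_function_sum_dilates[OF \<phi>]) simp
    have Du: "ordered_deriv \<alpha> u x = (\<Sum>k<K. h k * (1 / 2 ^ k) ^ m * ordered_deriv \<alpha> \<phi> ((1 / 2 ^ k) *\<^sub>R x))"
      if "\<alpha> \<in> I" for \<alpha> x
      unfolding ordered_deriv_def u_def foldr_partial_deriv_sum_dilates[OF \<phi>]
      using I(2)[OF that] by (simp add: length_chosen_list)
    define r where "r = 1 + Cm * S"
    have r: "1 \<le> r" "0 < r" using Cm S(2) by (auto simp: r_def add_pos_nonneg)
    define c where "c k = L' * (h k * (1 / 2 ^ k) ^ m / r)" for k :: nat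
    have c: "0 \<le> c k" for k using L' h r by (simp add: c_def)
    have Wc: "W * (c k / (2 ^ k) powr \<sigma>) = 1 / r * g k" for k
    proof -
      have "(2 ^ k) ^ m = (2::real) powr (real m * real k)"
        by (simp add: powr_realpow[symmetric] powr_powr mult.commute)
      moreover have "(2 ^ k) powr \<sigma> = (2::real) powr (\<sigma> * real k)"
        by (simp add: powr_realpow[symmetric] powr_powr mult.commute)
      ultimately have "2 powr (s * real k) = (2 ^ k) ^ m * (2 ^ k) powr \<sigma>"
        by (simp only: s_eq distrib_right powr_add)
      then show ?thesis using W L' r by (simp add: c_def h_def power_one_over)
    qed
    have "frac_modular \<sigma> A I (\<lambda>x \<alpha>. ordered_deriv \<alpha> u x / r)
        \<le> (\<Sum>k<K. ennreal (Cm * 2 ^ (k * ?n)) * A (W * (c k / (2 ^ k) powr \<sigma>)))"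
    proof (rule modular[rule_format, OF c])
      fix x y :: "real ^ 'n"
      define e where "e k = min (norm (x - y) / 2 ^ k) 1
          * (if norm x \<le> R * 2 ^ k \<or> norm y \<le> R * 2 ^ k then 1 else 0 :: real)" for k :: nat
      have e: "0 \<le> e k" for k by (simp add: e_def)
      have one: "\<bar>ordered_deriv \<alpha> u x / r - ordered_deriv \<alpha> u y / r\<bar> \<le> (\<Sum>k<K. L * (h k * (1 / 2 ^ k) ^ m / r) * e k)"
        if \<alpha>: "\<alpha> \<in> I" for \<alpha>
      proof -
        have eq: "ordered_deriv \<alpha> u x / r - ordered_deriv \<alpha> u y / r
          = (\<Sum>k<K. (h k * (1 / 2 ^ k) ^ m / r) * (ordered_deriv \<alpha> \<phi> ((1 / 2 ^ k) *\<^sub>R x) - ordered_deriv \<alpha> \<phi> ((1 / 2 ^ k) *\<^sub>R y)))"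
          by (simp add: Du[OF \<alpha>] sum_divide_distrib sum_subtractf[symmetric] right_diff_distrib)
        have "\<bar>ordered_deriv \<alpha> u x / r - ordered_deriv \<alpha> u y / r\<bar> \<le> (\<Sum>k<K. \<bar>(h k * (1 / 2 ^ k) ^ m / r) * (ordered_deriv \<alpha> \<phi> ((1 / 2 ^ k) *\<^sub>R x) - ordered_deriv \<alpha> \<phi> ((1 / 2 ^ k) *\<^sub>R y))\<bar>)"
          unfolding eq by (rule sum_abs)
        also have "\<dots> \<le> (\<Sum>k<K. L * (h k * (1 / 2 ^ k) ^ m / r) * e k)"
        proof (rule sum_mono)
          fix k
          have n: "norm ((1 / 2 ^ k) *\<^sub>R x - (1 / 2 ^ k) *\<^sub>R y) = norm (x - y) / 2 ^ k"
            unfolding scaleR_diff_right[symmetric] by simp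
          have n': "norm ((1 / 2 ^ k) *\<^sub>R z) \<le> R \<longleftrightarrow> norm z \<le> R * 2 ^ k" for z :: "real ^ 'n"
            by (simp add: pos_divide_le_eq)
          have "\<bar>ordered_deriv \<alpha> \<phi> ((1 / 2 ^ k) *\<^sub>R x) - ordered_deriv \<alpha> \<phi> ((1 / 2 ^ k) *\<^sub>R y)\<bar> \<le> L * e k"
            using osc[OF \<alpha>, of "(1 / 2 ^ k) *\<^sub>R x" "(1 / 2 ^ k) *\<^sub>R y"]
            unfolding n n' by (simp only: e_def mult.assoc)
          moreover have "0 \<le> h k * (1 / 2 ^ k) ^ m / r" using h r by simp
          ultimately have "(h k * (1 / 2 ^ k) ^ m / r) * \<bar>ordered_deriv \<alpha> \<phi> ((1 / 2 ^ k) *\<^sub>R x) - ordered_deriv \<alpha> \<phi> ((1 / 2 ^ k) *\<^sub>R y)\<bar>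
              \<le> (h k * (1 / 2 ^ k) ^ m / r) * (L * e k)"
            by (rule mult_left_mono)
          then show "\<bar>(h k * (1 / 2 ^ k) ^ m / r) * (ordered_deriv \<alpha> \<phi> ((1 / 2 ^ k) *\<^sub>R x) - ordered_deriv \<alpha> \<phi> ((1 / 2 ^ k) *\<^sub>R y))\<bar>
              \<le> L * (h k * (1 / 2 ^ k) ^ m / r) * e k"
            using \<open>0 \<le> h k * (1 / 2 ^ k) ^ m / r\<close> by (simp only: abs_mult abs_of_nonneg mult_ac)
        qed
        finally show ?thesis .
      qed
      have "L2_set (\<lambda>\<alpha>. ordered_deriv \<alpha> u x / r - ordered_deriv \<alpha> u y / r) I
          \<le> (\<Sum>\<alpha>\<in>I. \<bar>ordered_deriv \<alpha> u x / r - ordered_deriv \<alpha> u y / r\<bar>)"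
        by (rule L2_set_le_sum_abs)
      also have "\<dots> \<le> (\<Sum>\<alpha>\<in>I. \<Sum>k<K. L * (h k * (1 / 2 ^ k) ^ m / r) * e k)"
        by (intro sum_mono one)
      also have "\<dots> = (\<Sum>k<K. (real (card I) * L) * ((h k * (1 / 2 ^ k) ^ m / r) * e k))"
        by (simp add: sum_distrib_left mult.assoc)
      also have "\<dots> \<le> (\<Sum>k<K. L' * ((h k * (1 / 2 ^ k) ^ m / r) * e k))"
        using L' h r e by (intro sum_mono mult_right_mono) auto
      also have "\<dots> = (\<Sum>k<K. c k * e k)" by (simp only: c_def mult.assoc)
      finally show "L2_set (\<lambda>\<alpha>. ordered_deriv \<alpha> u x / r - ordered_deriv \<alpha> u y / r) I
          \<le> (\<Sum>k<K. c k * min (norm (x - y) / 2 ^ k) 1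
          * (if norm x \<le> R * 2 ^ k \<or> norm y \<le> R * 2 ^ k then 1 else 0))"
        by (simp only: e_def mult.assoc)
    qed
    also have "\<dots> \<le> (\<Sum>k<K. ennreal (Cm / r) * (ennreal (2 ^ (k * ?n)) * A (g k)))"
    proof (rule sum_mono)
      fix k
      have "ennreal (Cm * 2 ^ (k * ?n)) * A (W * (c k / (2 ^ k) powr \<sigma>))
          \<le> ennreal (Cm * 2 ^ (k * ?n)) * (ennreal (1 / r) * A (g k))"
        unfolding Wc using r g by (intro mult_left_mono young_scale[OF A]) auto
      also have "\<dots> = (ennreal (Cm * 2 ^ (k * ?n)) * ennreal (1 / r)) * A (g k)" by (simp only: mult.assoc)
      also have "ennreal (Cm * 2 ^ (k * ?n)) * ennreal (1 / r) = ennreal (Cm / r) * ennreal (2 ^ (k * ?n))"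
        using Cm r by (simp add: ennreal_mult[symmetric])
      finally show "ennreal (Cm * 2 ^ (k * ?n)) * A (W * (c k / (2 ^ k) powr \<sigma>))
          \<le> ennreal (Cm / r) * (ennreal (2 ^ (k * ?n)) * A (g k))" by (simp only: mult.assoc)
    qed
    also have "\<dots> = ennreal (Cm / r) * ennreal S" by (simp only: sum_distrib_left[symmetric] S(1))
    also have "\<dots> = ennreal (Cm / r * S)" using Cm r S(2) by (intro ennreal_mult[symmetric]) auto
    also have "\<dots> \<le> 1" using r by (simp add: r_def)
    finally have Vu: "V_functional s A u \<le> ennreal r"
      unfolding \<sigma>_def I_def m_def by (rule V_functional_le_if_modular_le_1[OF u r(2)])
    then have uV: "u \<in> V_space s A"
      by (intro test_function_in_V_space u) (auto intro: le_less_trans)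
    have "ennreal ((\<Sum>k<K. h k) * c0 * V) = (\<integral>\<^sup>+x\<in>cball 0 1. ennreal ((\<Sum>k<K. h k) * c0) \<partial>(lebesgue :: (real ^ 'n) measure))"
      using h c0 V by (simp add: nn_integral_cmult_indicator nn_integral_completion emB ennreal_mult sum_nonneg)
    also have "\<dots> \<le> (\<integral>\<^sup>+x\<in>cball 0 1. ennreal \<bar>u x\<bar> \<partial>lebesgue)"
    proof (intro nn_integral_mono)
      fix x :: "real ^ 'n"
      have "(\<Sum>k<K. h k) * c0 \<le> \<bar>u x\<bar>" if x: "x \<in> cball 0 1"
      proof -
        have "(1 / 2 ^ k) *\<^sub>R x \<in> cball 0 1" for k :: nat
        proof -
          have "norm x \<le> 2 ^ k" using x one_le_power[of "2::real" k] by (auto intro: order_trans)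
          then show ?thesis by (simp add: pos_divide_le_eq)
        qed
        then have "(\<Sum>k<K. h k) * c0 \<le> u x"
          unfolding u_def sum_distrib_right using h c0(2) by (intro sum_mono mult_left_mono) auto
        then show ?thesis by simp
      qed
      then show "ennreal ((\<Sum>k<K. h k) * c0) * indicator (cball 0 1) x \<le> ennreal \<bar>u x\<bar> * indicator (cball 0 1) x"
        by (auto simp: indicator_def intro!: ennreal_leI)
    qed
    also have "\<dots> \<le> ennreal Ce * ennreal r"
      using emb'[OF uV] mult_left_mono[OF Vu, of "ennreal Ce"] by (auto intro: order_trans)
    also have "\<dots> = ennreal (Ce * r)" using Ce r by (simp add: ennreal_mult)
    finally have hle: "(\<Sum>k<K. h k) * c0 * V \<le> Ce * r" using Ce r by simp
    have "(\<Sum>k<K. ennreal (2 powr (s * real k) * g k)) = ennreal (\<Sum>k<K. 2 powr (s * real k) * g k)"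
      using g by (intro sum_ennreal) auto
    also have "(\<Sum>k<K. 2 powr (s * real k) * g k) = W * L' / (c0 * V) * ((\<Sum>k<K. h k) * c0 * V)"
      using W L' c0 V by (simp add: h_def sum_divide_distrib[symmetric])
    also have "ennreal \<dots> \<le> ennreal (W * L' / (c0 * V) * (Ce * r))"
      using W L' c0 V by (intro ennreal_leI mult_left_mono hle) auto
    also have "\<dots> \<le> ennreal (C * (1 + S))"
    proof (rule ennreal_leI)
      have "r \<le> (1 + Cm) * (1 + S)" using Cm S(2) by (simp add: r_def algebra_simps)
      then have "W * L' / (c0 * V) * Ce * r \<le> W * L' / (c0 * V) * Ce * ((1 + Cm) * (1 + S))"
        using W L' c0 V Ce by (intro mult_left_mono) auto
      then show "W * L' / (c0 * V) * (Ce * r) \<le> C * (1 + S)" by (simp only: C_def mult.assoc)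
    qed
    also have "\<dots> = ennreal C * (1 + ennreal S)" using Cpos S(2) by (simp add: ennreal_mult ennreal_plus)
    finally show ?thesis by (simp only: S(1))
  qed
  then show ?thesis using Cpos by (intro exI[of _ C]) simp
qed

theorem theorem3p1:
  fixes s :: real and A :: "real \<Rightarrow> ennreal"
  assumes "s \<in> {0<..} - \<nat>"
    and "young_function A"
    and "\<exists>Y :: (real ^ 'n \<Rightarrow> real) \<Rightarrow> ennreal.
           rearrangement_invariant_norm Y \<and> continuous_V_embedding s A Y"
  shows "s \<in> {0<..<real CARD('n)} - \<nat> \<and>
         integrable_near_0
           (\<lambda>t. ennreal_powr (ennreal t / A t) (s / (real CARD('n) - s)))"
proof -
  have s: "0 < s" "s \<notin> \<nat>" using assms(1) by auto
  obtain Y :: "(real ^ 'n \<Rightarrow> real) \<Rightarrow> ennreal"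
    where Y: "rearrangement_invariant_norm Y" "continuous_V_embedding s A Y" using assms(3) by blast
  obtain C where C0: "0 \<le> C" and C': "\<forall>(K::nat) g. (\<forall>k. 0 \<le> g k) \<longrightarrow>
      (\<Sum>k<K. ennreal (2 powr (s * real k) * g k))
        \<le> ennreal C * (1 + (\<Sum>k<K. ennreal (2 ^ (k * CARD('n))) * A (g k)))"
    using embedding_imp_discrete_criterion[OF s assms(2) Y] by (elim exE conjE)
  note C = C'[rule_format]
  have "s \<noteq> real CARD('n)" using s(2) by auto
  then have less: "s < real CARD('n)"
    by (rule discrete_criterion_imp_less[OF assms(2) s(1) _ C0 C])
  have "integrable_near_0 (\<lambda>t. ennreal_powr (ennreal t / A t) (s / (real CARD('n) - s)))"
    by (rule discrete_criterion_imp_integrable[OF assms(2) s(1) less C0 C])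
  then show ?thesis using s less by simp
qed

end
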